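(* Every tree $T$ of diameter six has a unique central vertex $c$, and every component of $T-c$, rooted at its neighbor of $c$, has height at most two. Encode each such rooted branch $B$ by the integer partition $\pi(B)$ that has one part for each child $x$ of the root of $B$, this part being $1$ if $x$ has no children in $B$, and being $q\ge 2$ if $x$ has exactly $q-1$ children in $B$ (all of which are then leaves); the one-vertex branch is encoded by the empty partition. Then the assignment sending $T$ to the multiset $\{\!\{\pi_1,\dots,\pi_s\}\!\}$ of the partitions encoding the components of $T-c$ induces a bijection from the set of isomorphism classes of (unlabelled) trees of diameter six to the set of finite multisets of integer partitions (the empty partition being allowed as a member) in which at least two members, counted with multiplicity, contain a part that is at least two. Moreover, if $T$ corresponds to $\{\!\{\pi_1,\dots,\pi_s\}\!\}$, then $$|V(T)|=1+\sum_{i=1}^s\bigl(1+|\pi_i|\bigr).$$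
   Context: All trees are finite. The diameter of a tree is the maximum number of edges in a path; a central vertex is a vertex minimizing the maximum distance to the other vertices. The height of a rooted tree is the maximum distance from its root to a vertex. An integer partition $\pi$ is a finite multiset of positive integers, called its parts, and $|\pi|$ denotes the sum of its parts (so $|\emptyset|=0$). *)

theory Defs
  imports "Graph_Theory.Graph_Theory" "HOL-Library.Multiset"
begin

text \<open>
  Undirected simple graphs are the finite symmetric loop-free digraphs without parallel arcs
  (locale \<^locale>\<open>graph\<close>). The library's \<^const>\<open>tree\<close> forbids all directed
  cycles; in a symmetric digraph an edge traversed back and forth is one, so
  \<^const>\<open>tree\<close> is not usable here. Cycles of an undirected graph have length at least 3.
\<close>

definition undirected_tree :: "('a, 'b) pre_digraph \<Rightarrow> bool" where
  "undirected_tree G \<longleftrightarrow>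
     graph G \<and> Digraph_Component.connected G \<and> \<not> (\<exists>p. pre_digraph.cycle G p \<and> 3 \<le> length p)"

definition diameter :: "('a, 'b) pre_digraph \<Rightarrow> nat" where
  "diameter G = Max {length p |u p v. pre_digraph.apath G u p v}"

text \<open>The hop distance is the cost of a shortest walk when every arc has cost 1.\<close>

definition hop_dist :: "('a, 'b) pre_digraph \<Rightarrow> 'a \<Rightarrow> 'a \<Rightarrow> ereal" where
  "hop_dist G u v = wf_digraph.\<mu> G (\<lambda>_. 1) u v"

definition eccentricity :: "('a, 'b) pre_digraph \<Rightarrow> 'a \<Rightarrow> ereal" where
  "eccentricity G v = Max (hop_dist G v ` verts G)"

definition central_vertex :: "('a, 'b) pre_digraph \<Rightarrow> 'a \<Rightarrow> bool" where
  "central_vertex G c \<longleftrightarrow> is_arg_min (eccentricity G) (\<lambda>v. v \<in> verts G) c"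

definition center :: "('a, 'b) pre_digraph \<Rightarrow> 'a" where
  "center G = (THE c. central_vertex G c)"


text \<open>A rooted tree is given by a tree \<open>B\<close> together with a vertex \<open>r\<close> of it.\<close>

definition height :: "('a, 'b) pre_digraph \<Rightarrow> 'a \<Rightarrow> ereal" where
  "height B r = eccentricity B r"

definition children :: "('a, 'b) pre_digraph \<Rightarrow> 'a \<Rightarrow> 'a \<Rightarrow> 'a set" where
  "children B r x = {y. (x, y) \<in> arcs_ends B \<and> hop_dist B r y = hop_dist B r x + 1}"


text \<open>
  In a symmetric digraph the strongly connected components are the connected components.
\<close>

definition branches :: "('a, 'b) pre_digraph \<Rightarrow> 'a \<Rightarrow> ('a, 'b) pre_digraph set" where
  "branches T c = pre_digraph.sccs (pre_digraph.del_vert T c)"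

definition branch_root :: "('a, 'b) pre_digraph \<Rightarrow> 'a \<Rightarrow> ('a, 'b) pre_digraph \<Rightarrow> 'a" where
  "branch_root T c B = (THE r. r \<in> verts B \<and> (c, r) \<in> arcs_ends T)"


definition integer_partition :: "nat multiset \<Rightarrow> bool" where
  "integer_partition \<pi> \<longleftrightarrow> (\<forall>q \<in># \<pi>. 0 < q)"

definition branch_partition :: "('a, 'b) pre_digraph \<Rightarrow> 'a \<Rightarrow> nat multiset" where
  "branch_partition B r =
     {#if children B r x = {} then 1 else card (children B r x) + 1.
        x \<in># mset_set (children B r r)#}"

definition tree_code :: "('a, 'b) pre_digraph \<Rightarrow> nat multiset multiset" where
  "tree_code T =
     {#branch_partition B (branch_root T (center T) B). B \<in># mset_set (branches T (center T))#}"

definition admissible_codes :: "nat multiset multiset set" where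
  "admissible_codes =
     {M. (\<forall>\<pi> \<in># M. integer_partition \<pi>) \<and> 2 \<le> size {#\<pi> \<in># M. \<exists>q \<in># \<pi>. 2 \<le> q#}}"


text \<open>Pair digraphs have no arc labels, so a simple graph is determined by its vertices and edges.\<close>

definition diam6_trees :: "'a pair_pre_digraph set" where
  "diam6_trees = {T. undirected_tree (with_proj T) \<and> diameter (with_proj T) = 6}"

definition diam6_iso :: "'a pair_pre_digraph rel" where
  "diam6_iso =
     {(T, T'). T \<in> diam6_trees \<and> T' \<in> diam6_trees \<and> digraph_iso (with_proj T) (with_proj T')}"

definition diam6_code :: "'a pair_pre_digraph \<Rightarrow> nat multiset multiset" where
  "diam6_code T = tree_code (with_proj T)"

end

theory Submission
  imports Defs
begin

text \<open>
  Rooting a tree at \<open>c\<close> and recording parents \<open>f\<close> and depths \<open>d\<close> turns every edge into a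
  child-parent pair: an edge between \<open>x\<close> and \<open>y\<close> of any other kind would, together with the two
  descents to the root, form a closed walk without backtracking, and in an acyclic graph such walks
  have distinct vertices. In a rooted tree a walk without backtracking first descends to its
  lowest point and then climbs, so its length is at most the sum of the depths of its ends;
  conversely two vertices in different branches at the root are joined by a path of exactly that
  length. Hence a tree has diameter six iff, rooted at the middle \<open>c\<close> of a longest path, it has
  depth three and vertices of depth three in two different branches. Any other vertex is at
  distance at least four from one of these two, so \<open>c\<close> is the unique centre. Such a rooted tree is
  determined up to isomorphism by the numbers of children on its first levels, which is what the
  multiset of partitions records.
\<close>

section \<open>Walks as vertex lists\<close>

fun reduced :: "'a list \<Rightarrow> bool" where
  "reduced (x # y # z # zs) \<longleftrightarrow> x \<noteq> z \<and> reduced (y # z # zs)"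
| "reduced _ \<longleftrightarrow> True"

lemma reduced_ConsD: "reduced (x # xs) \<Longrightarrow> reduced xs"
  by (cases "x # xs" rule: reduced.cases) auto

lemma distinct_reduced: "distinct xs \<Longrightarrow> reduced xs"
  by (induction xs rule: reduced.induct) auto

text \<open>Only the triple starting at the repeated end point is not covered by
  \<open>distinct (tl xs)\<close>. There the first vertex equals the last one, which occurs strictly
  after the third position since the list has at least four entries.\<close>

lemma closed_distinct_reduced:
  assumes "distinct (tl xs)" "hd xs = last xs" "length xs \<ge> 4"
  shows "reduced xs"
proof -
  obtain x y z w ws where xs: "xs = x # y # z # w # ws"
    using assms(3) by (auto simp: numeral_eq_Suc Suc_le_length_iff)
  have "reduced (y # z # w # ws)"
    using assms(1) xs by (auto intro: distinct_reduced simp del: reduced.simps)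
  moreover have "last (w # ws) \<noteq> z"
    using assms(1) xs last_in_set[of "w # ws"] by (auto simp del: last_in_set last.simps)
  ultimately show ?thesis using assms(2) xs by auto
qed

text \<open>Both lists are read outward from the edge \<open>x\<close>-\<open>y\<close>.
  Backtracking could arise only in the two triples straddling that edge, which the last two
  hypotheses exclude. The induction moves the edge leftwards through \<open>us\<close>.\<close>

lemma reduced_join:
  "reduced (x # us) \<Longrightarrow> reduced (y # vs) \<Longrightarrow> us = [] \<or> hd us \<noteq> y \<Longrightarrow> vs = [] \<or> hd vs \<noteq> x
    \<Longrightarrow> reduced (rev us @ x # y # vs)"
proof (induction us arbitrary: x y vs)
  case Nil
  then show ?case by (cases vs) auto
next
  case (Cons u us)
  have "reduced (rev us @ u # x # y # vs)"
  proof (rule Cons.IH)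
    show "reduced (u # us)" using Cons.prems(1) by (rule reduced_ConsD)
    show "reduced (x # y # vs)" using Cons.prems by (cases vs) auto
    show "us = [] \<or> hd us \<noteq> x" using Cons.prems(1) by (cases us) auto
    show "y # vs = [] \<or> hd (y # vs) \<noteq> u" using Cons.prems(3) by auto
  qed
  then show ?case by simp
qed

lemma strictly_decreasing_distinct:
  fixes d :: "'a \<Rightarrow> nat"
  assumes "sorted_wrt (\<lambda>x y. d y < d x) xs"
  shows "distinct xs"
  using assms by (induction xs) auto

section \<open>Translation between arc walks and vertex lists\<close>

lemma vwalk_append:
  assumes "vwalk p G" "vwalk q G" "(last p, hd q) \<in> arcs_ends G"
  shows "vwalk (p @ q) G"
  using assms by (auto simp: vwalk_def vwalk_arcs_append)

lemma pawalk_verts_vwalk_arcs: "xs \<noteq> [] \<Longrightarrow> pawalk_verts (hd xs) (vwalk_arcs xs) = xs"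
  by (induction xs rule: vwalk_arcs.induct) auto

lemma vwalk_imp_awalk:
  assumes "wf_digraph (with_proj T)" "vwalk xs (with_proj T)"
  shows "pre_digraph.awalk (with_proj T) (hd xs) (vwalk_arcs xs) (last xs)"
proof -
  interpret wf_digraph "with_proj T" by fact
  show ?thesis using assms(2)
    by (induction xs rule: vwalk_arcs.induct) (auto simp: awalk_simps)
qed

lemma awalk_imp_vwalk_ends:
  assumes "wf_digraph (with_proj T)" "pre_digraph.awalk (with_proj T) u p v"
  shows "vwalk (pawalk_verts u p) (with_proj T)" "hd (pawalk_verts u p) = u"
    "last (pawalk_verts u p) = v" "length (pawalk_verts u p) = Suc (length p)"
proof -
  interpret wf_digraph "with_proj T" by fact
  show "vwalk (pawalk_verts u p) (with_proj T)" "hd (pawalk_verts u p) = u"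
    "last (pawalk_verts u p) = v" "length (pawalk_verts u p) = Suc (length p)"
    using awalk_imp_vwalk[OF assms(2)] assms(2)
      length_awalk_verts[of u p] awhd_of_awalk[OF assms(2)] awlast_of_awalk[OF assms(2)]
    by (auto simp: awalk_verts_with_proj_eq NOMATCH_def)
qed

lemma length_vwalk_arcs: "length (vwalk_arcs xs) = length xs - 1"
  by (induction xs rule: vwalk_arcs.induct) auto

lemma awalk_cost_one:
  fixes G :: "('a, 'b) pre_digraph" and p :: "'b list"
  shows "wf_digraph G \<Longrightarrow> wf_digraph.awalk_cost (\<lambda>_. 1) p = real (length p)"
  by (simp add: wf_digraph.awalk_cost_def[of G] sum_list_triv)

lemma hop_dist_le:
  assumes "wf_digraph (with_proj T)" "vwalk xs (with_proj T)"
  shows "hop_dist (with_proj T) (hd xs) (last xs) \<le> ereal (length xs - 1)"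
  using wf_digraph.min_cost_le_walk_cost[OF assms(1) vwalk_imp_awalk[OF assms], of "\<lambda>_. 1"]
  by (simp add: hop_dist_def awalk_cost_one[OF assms(1)] length_vwalk_arcs)

lemma vwalk_potential:
  fixes \<phi> :: "'a \<Rightarrow> int"
  assumes "vwalk xs G" "\<And>x y. (x, y) \<in> arcs_ends G \<Longrightarrow> \<phi> y \<le> \<phi> x + 1"
  shows "\<phi> (last xs) - \<phi> (hd xs) \<le> int (length xs - 1)"
  using assms(1)
proof (induction xs rule: vwalk_induct)
  case (Cons u v es)
  then show ?case using assms(2)[of u v] by auto
qed auto

text \<open>Distances are bounded below by exhibiting an integer potential that rises by at most one
  along each arc, so no shortest walk has to be known. The instances used later are the depth and a
  signed depth.\<close>

lemma hop_dist_ge: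
  fixes \<phi> :: "'a \<Rightarrow> int"
  assumes "wf_digraph (with_proj T)" "\<And>x y. (x, y) \<in> parcs T \<Longrightarrow> \<phi> y \<le> \<phi> x + 1"
  shows "ereal (\<phi> v - \<phi> u) \<le> hop_dist (with_proj T) u v"
  unfolding hop_dist_def wf_digraph.\<mu>_def[OF assms(1)]
proof (rule INF_greatest)
  fix p assume "p \<in> {p. pre_digraph.awalk (with_proj T) u p v}"
  then have p: "pre_digraph.awalk (with_proj T) u p v" by simp
  have "\<phi> v - \<phi> u \<le> int (length p)"
    using vwalk_potential[of "pawalk_verts u p" "with_proj T" \<phi>] awalk_imp_vwalk_ends[OF assms(1) p]
      assms(2) by simp
  then have "real_of_int (\<phi> v - \<phi> u) \<le> real_of_int (int (length p))"
    by (subst of_int_le_iff)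
  then show "ereal (\<phi> v - \<phi> u) \<le> ereal (wf_digraph.awalk_cost (\<lambda>_. 1) p)"
    by (simp add: awalk_cost_one[OF assms(1)])
qed

text \<open>An arc of a pair digraph is its pair of ends, so a path is determined by its vertices.
  The \<open>- 1\<close> converts a number of vertices into a number of edges.\<close>

lemma apath_lengths_eq:
  assumes "wf_digraph (with_proj T)"
  shows "{length p |u p v. pre_digraph.apath (with_proj T) u p v}
    = {length xs - 1 |xs. vwalk xs (with_proj T) \<and> distinct xs}"
proof (intro set_eqI iffI)
  fix n assume "n \<in> {length p |u p v. pre_digraph.apath (with_proj T) u p v}"
  then obtain u p v where "pre_digraph.apath (with_proj T) u p v" "n = length p" by auto
  then show "n \<in> {length xs - 1 |xs. vwalk xs (with_proj T) \<and> distinct xs}"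
    using awalk_imp_vwalk_ends[OF assms, of u p v]
    by (auto simp: pre_digraph.apath_def awalk_verts_with_proj_eq intro!: exI[of _ "pawalk_verts u p"])
next
  fix n assume "n \<in> {length xs - 1 |xs. vwalk xs (with_proj T) \<and> distinct xs}"
  then obtain xs where "vwalk xs (with_proj T)" "distinct xs" "n = length xs - 1" by auto
  moreover from this have "xs \<noteq> []" by auto
  ultimately have "pre_digraph.apath (with_proj T) (hd xs) (vwalk_arcs xs) (last xs)"
    "n = length (vwalk_arcs xs)"
    using vwalk_imp_awalk[OF assms, of xs]
    by (auto simp: pre_digraph.apath_def awalk_verts_with_proj_eq pawalk_verts_vwalk_arcs length_vwalk_arcs)
  then show "n \<in> {length p |u p v. pre_digraph.apath (with_proj T) u p v}" by blast
qed

text \<open>The vertex list of a closed walk names its base point at both ends, so three arcs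
  correspond to four entries.\<close>

lemma ex_cycle_iff:
  assumes "wf_digraph (with_proj T)"
  shows "(\<exists>p. pre_digraph.cycle (with_proj T) p \<and> 3 \<le> length p) \<longleftrightarrow>
    (\<exists>xs. vwalk xs (with_proj T) \<and> hd xs = last xs \<and> distinct (tl xs) \<and> 4 \<le> length xs)"
proof
  assume "\<exists>p. pre_digraph.cycle (with_proj T) p \<and> 3 \<le> length p"
  then obtain p u where "pre_digraph.awalk (with_proj T) u p u"
    "distinct (tl (pawalk_verts u p))" "3 \<le> length p"
    by (auto simp: pre_digraph.cycle_def awalk_verts_with_proj_eq)
  then show "\<exists>xs. vwalk xs (with_proj T) \<and> hd xs = last xs \<and> distinct (tl xs) \<and> 4 \<le> length xs"
    using awalk_imp_vwalk_ends[OF assms, of u p u] by (auto intro!: exI[of _ "pawalk_verts u p"])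
next
  assume "\<exists>xs. vwalk xs (with_proj T) \<and> hd xs = last xs \<and> distinct (tl xs) \<and> 4 \<le> length xs"
  then obtain xs where xs: "vwalk xs (with_proj T)" "hd xs = last xs" "distinct (tl xs)" "4 \<le> length xs"
    by auto
  then have "xs \<noteq> []" by auto
  then have "pre_digraph.cycle (with_proj T) (vwalk_arcs xs)" "3 \<le> length (vwalk_arcs xs)"
    using vwalk_imp_awalk[OF assms xs(1)] xs pawalk_verts_vwalk_arcs[of xs]
    by (auto simp: pre_digraph.cycle_def awalk_verts_with_proj_eq length_vwalk_arcs
        simp flip: length_greater_0_conv intro!: exI[of _ "hd xs"])
  then show "\<exists>p. pre_digraph.cycle (with_proj T) p \<and> 3 \<le> length p" by blast
qed

section \<open>Rooted trees\<close>

text \<open>Storing a tree as a parent function orients every edge towards the root, so that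
  structural claims become inductions on depth.\<close>

definition tree_graph :: "'a set \<Rightarrow> 'a \<Rightarrow> ('a \<Rightarrow> 'a) \<Rightarrow> 'a pair_pre_digraph" where
  "tree_graph V c f =
     \<lparr>pverts = V, parcs = (\<lambda>v. (v, f v)) ` (V - {c}) \<union> (\<lambda>v. (f v, v)) ` (V - {c})\<rparr>"

definition kids :: "'a set \<Rightarrow> 'a \<Rightarrow> ('a \<Rightarrow> 'a) \<Rightarrow> 'a \<Rightarrow> 'a set" where
  "kids V c f x = {y \<in> V - {c}. f y = x}"

text \<open>
  No case distinction is needed here, since \<open>card {} + 1\<close> is the part \<open>1\<close> of a childless vertex.
\<close>

definition nested_code :: "'a set \<Rightarrow> 'a \<Rightarrow> ('a \<Rightarrow> 'a) \<Rightarrow> nat multiset multiset" where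
  "nested_code V c f =
     {#{#card (kids V c f x) + 1. x \<in># mset_set (kids V c f r)#}. r \<in># mset_set (kids V c f c)#}"

text \<open>The value \<open>f c\<close> is junk and left unconstrained.\<close>

locale rooted_tree =
  fixes V :: "'a set" and c :: 'a and f :: "'a \<Rightarrow> 'a" and d :: "'a \<Rightarrow> nat"
  assumes finite_V: "finite V"
    and root_in: "c \<in> V"
    and depth_root: "d c = 0"
    and parent_in: "v \<in> V \<Longrightarrow> v \<noteq> c \<Longrightarrow> f v \<in> V"
    and depth_parent: "v \<in> V \<Longrightarrow> v \<noteq> c \<Longrightarrow> d v = Suc (d (f v))"
begin

abbreviation "G \<equiv> tree_graph V c f"
abbreviation "K \<equiv> kids V c f"

lemma pverts_G [simp]: "pverts G = V"
  by (simp add: tree_graph_def)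

lemma edge_iff:
  "(x, y) \<in> parcs G \<longleftrightarrow> (x \<in> V \<and> x \<noteq> c \<and> y = f x) \<or> (y \<in> V \<and> y \<noteq> c \<and> x = f y)"
  by (auto simp: tree_graph_def)

lemma edge_in: "(x, y) \<in> parcs G \<Longrightarrow> x \<in> V \<and> y \<in> V"
  by (auto simp: edge_iff parent_in)

lemma edge_sym: "(x, y) \<in> parcs G \<Longrightarrow> (y, x) \<in> parcs G"
  by (auto simp: edge_iff)

lemma edge_parent: "v \<in> V \<Longrightarrow> v \<noteq> c \<Longrightarrow> (v, f v) \<in> parcs G \<and> (f v, v) \<in> parcs G"
  by (auto simp: edge_iff)

lemma depth_0_iff: "v \<in> V \<Longrightarrow> d v = 0 \<longleftrightarrow> v = c"
  using depth_parent[of v] depth_root by (cases "v = c") auto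

lemma K_iff: "y \<in> K x \<longleftrightarrow> y \<in> V \<and> y \<noteq> c \<and> f y = x"
  by (auto simp: kids_def)

lemma finite_K [simp]: "finite (K x)"
  using finite_V by (simp add: kids_def)

lemma depth_K: "y \<in> K x \<Longrightarrow> d y = Suc (d x)"
  using depth_parent[of y] by (auto simp: K_iff)

lemma edge_cases:
  assumes "(x, y) \<in> parcs G"
  obtains "x \<in> V" "x \<noteq> c" "y = f x" "d x = Suc (d y)" | "y \<in> V" "y \<noteq> c" "x = f y" "d y = Suc (d x)"
  using assms depth_parent unfolding edge_iff by blast

lemma graph_G: "pair_graph G"
proof
  show "finite (pverts G)" "finite (parcs G)" using finite_V by (auto simp: tree_graph_def)
  show "Digraph.symmetric (with_proj G)"
    using edge_sym by (auto simp: symmetric_def intro: symI)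
  show "fst e \<in> pverts G" "snd e \<in> pverts G" if "e \<in> parcs G" for e
    using that edge_in[of "fst e" "snd e"] by auto
  show "fst e \<noteq> snd e" if "e \<in> parcs G" for e
    using that by (cases e) (auto elim: edge_cases)
qed

lemma wf_G: "wf_digraph (with_proj G)"
  using graph_G by (simp add: pair_graph_def pair_digraph_def pair_fin_digraph_def wf_digraph_wp_iff)

lemma symmetric_G: "Digraph.symmetric (with_proj G)"
  using edge_sym by (auto simp: symmetric_def intro: symI)

lemma vwalk_Cons_iff:
  "vwalk (x # y # xs) (with_proj G) \<longleftrightarrow> (x, y) \<in> parcs G \<and> vwalk (y # xs) (with_proj G)"
  using wf_digraph.vwalk_Cons_Cons[OF wf_G] by simp

section \<open>Walks without backtracking in a rooted tree\<close>

lemma depth_last_upwards: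
  assumes "vwalk (x # y # zs) (with_proj G)" "reduced (x # y # zs)" "y \<noteq> c" "x = f y"
  shows "d (last (y # zs)) = d x + length (y # zs)"
  using assms
proof (induction zs arbitrary: x y)
  case Nil
  then show ?case using edge_in[of x y] depth_parent[of y] by (auto simp: vwalk_Cons_iff)
next
  case (Cons z zs)
  from Cons.prems have yz: "(y, z) \<in> parcs G" "z \<noteq> x" "y \<in> V"
    by (auto simp: vwalk_Cons_iff dest: edge_in)
  then have xy: "d y = Suc (d x)" using Cons.prems depth_parent by auto
  have "z \<noteq> c" "y = f z" using Cons.prems yz by (auto simp: edge_iff)
  with Cons.IH[of y z] Cons.prems xy show ?case
    by (auto simp: vwalk_Cons_iff intro: reduced_ConsD)
qed

text \<open>A step towards the root is paid for by the drop in the depth of the head. From the first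
  step away from the root on, the walk can never turn, since the parent is the only neighbour of
  smaller depth and has just been left; \<open>depth_last_upwards\<close> then gives the exact
  length.\<close>

lemma reduced_length_le:
  assumes "vwalk xs (with_proj G)" "reduced xs"
  shows "length xs \<le> d (hd xs) + d (last xs) + 1"
  using assms
proof (induction xs rule: induct_list012)
  case (3 x y zs)
  then have "(x, y) \<in> parcs G" by (auto simp: vwalk_Cons_iff)
  then show ?case
  proof (cases rule: edge_cases)
    case 1
    then show ?thesis using "3.IH"(2) "3.prems" by (auto simp: vwalk_Cons_iff dest: reduced_ConsD)
  next
    case 2
    then show ?thesis using depth_last_upwards[of x y zs] "3.prems" by auto
  qed
qed auto

text \<open>If the first step led away from the root, the walk would end strictly deeper than it
  began.\<close>

lemma closed_reduced_first_step:
  assumes "vwalk (x # y # zs) (with_proj G)" "reduced (x # y # zs)" "last (y # zs) = x"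
  shows "y = f x"
proof -
  have "(x, y) \<in> parcs G" using assms(1) by (auto simp: vwalk_Cons_iff)
  then show ?thesis
  proof (cases rule: edge_cases)
    case 2
    then show ?thesis using depth_last_upwards[of x y zs] assms by auto
  qed
qed

text \<open>A cycle and its reversal both leave the base point towards its parent, so the second and
  the penultimate vertex coincide, against distinctness.\<close>

lemma no_cycle:
  assumes "vwalk xs (with_proj G)" "hd xs = last xs" "distinct (tl xs)" "4 \<le> length xs"
  shows False
proof -
  obtain x y zs w where xs: "xs = x # y # zs @ [w, x]"
  proof -
    obtain x y ys where "xs = x # y # ys" "2 \<le> length ys"
      using assms(4) by (auto simp: numeral_eq_Suc Suc_le_length_iff)
    moreover from this obtain w z zs where "ys = zs @ [w, z]"
      by (cases ys rule: rev_cases; cases "butlast ys" rule: rev_cases) auto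
    ultimately show ?thesis using assms(2) that by auto
  qed
  have "y = f x"
    using assms closed_distinct_reduced[of xs] xs
    by (intro closed_reduced_first_step[of x y "zs @ [w, x]"]) auto
  moreover have "w = f x"
  proof (rule closed_reduced_first_step)
    show "vwalk (x # w # rev zs @ [y, x]) (with_proj G)"
      using vwalk_rev_ex[OF symmetric_G assms(1)] xs by simp
    show "reduced (x # w # rev zs @ [y, x])"
      using assms closed_distinct_reduced[of "rev xs"] xs by auto
  qed simp
  ultimately show False using assms(3) xs by auto
qed

text \<open>Decreasing depth makes the descent distinct, hence free of backtracking. The last clause
  is recorded for gluing two descents along an edge: it tells when such an edge would be traversed
  back.\<close>

lemma ex_chain:
  assumes "v \<in> V"
  shows "\<exists>xs. vwalk (v # xs) (with_proj G) \<and> last (v # xs) = c \<and> length xs = d v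
    \<and> sorted_wrt (\<lambda>x y. d y < d x) (v # xs) \<and> (xs = [] \<or> hd xs = f v)"
  using assms
proof (induction "d v" arbitrary: v)
  case 0
  then show ?case using depth_0_iff by (intro exI[of _ "[]"]) auto
next
  case (Suc n)
  then have "v \<noteq> c" using depth_root by auto
  then have v: "v \<noteq> c" "f v \<in> V" "d v = Suc (d (f v))"
    using Suc.prems parent_in depth_parent by blast+
  with Suc obtain xs where "vwalk (f v # xs) (with_proj G)" "last (f v # xs) = c" "length xs = d (f v)"
    "sorted_wrt (\<lambda>x y. d y < d x) (f v # xs)" by auto
  then show ?case using v edge_parent[of v] Suc.prems
    by (intro exI[of _ "f v # xs"]) (auto simp: vwalk_Cons_iff)
qed

lemma reachable_root: "v \<in> V \<Longrightarrow> v \<rightarrow>\<^sup>*\<^bsub>with_proj G\<^esub> c"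
proof (induction "d v" arbitrary: v)
  case 0
  then show ?case using depth_0_iff wf_digraph.reachable_refl[OF wf_G] by auto
next
  case (Suc n)
  then have "v \<noteq> c" using depth_root by auto
  then have "f v \<in> V" "d v = Suc (d (f v))" "(v, f v) \<in> parcs G"
    using Suc.prems parent_in depth_parent edge_parent by blast+
  then show ?case using Suc.hyps
    by (intro wf_digraph.adj_reachable_trans[OF wf_G, of v "f v"]) auto
qed

lemma strongly_connected_G: "strongly_connected (with_proj G)"
proof (rule strongly_connectedI)
  fix u v assume "u \<in> verts (with_proj G)" "v \<in> verts (with_proj G)"
  then show "u \<rightarrow>\<^sup>*\<^bsub>with_proj G\<^esub> v"
    using reachable_root[of u] symmetric_reachable[OF symmetric_G reachable_root[of v]]
    by (auto intro: wf_digraph.reachable_trans[OF wf_G])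
qed (use root_in in auto)

lemma undirected_tree_G: "undirected_tree (with_proj G)"
proof -
  \<comment> \<open>\<open>Digraph_Component.connected\<close> refers to the symmetric closure,
    which leaves this graph unchanged.\<close>
  have "mk_symmetric (with_proj G) = G"
    using edge_sym by (intro pair_pre_digraph.equality) (auto simp: mk_symmetric_def)
  then show ?thesis
    using strongly_connected_G no_cycle pair_graph.pair_graphD_graph[OF graph_G]
    by (auto simp: undirected_tree_def Digraph_Component.connected_def ex_cycle_iff[OF wf_G])
qed

text \<open>The reversed descent gives the upper bound, and the depth itself is the potential for
  the lower bound.\<close>

lemma hop_dist_root:
  assumes "v \<in> V"
  shows "hop_dist (with_proj G) c v = ereal (d v)"
proof (rule antisym)
  obtain xs where xs: "vwalk (v # xs) (with_proj G)" "last (v # xs) = c" "length xs = d v"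
    using ex_chain[OF assms] by auto
  have "hop_dist (with_proj G) (hd (rev (v # xs))) (last (rev (v # xs))) \<le> ereal (length (rev (v # xs)) - 1)"
    by (rule hop_dist_le[OF wf_G vwalk_rev_ex[OF symmetric_G xs(1)]])
  then show "hop_dist (with_proj G) c v \<le> ereal (d v)"
    using xs by (simp add: hd_rev last_rev del: rev.simps)
  have "ereal (int (d v) - int (d c)) \<le> hop_dist (with_proj G) c v"
    by (rule hop_dist_ge[OF wf_G]) (auto elim: edge_cases)
  then show "ereal (d v) \<le> hop_dist (with_proj G) c v" using depth_root by simp
qed

lemma eccentricity_root: "eccentricity (with_proj G) c = Max ((\<lambda>v. ereal (d v)) ` V)"
  by (simp add: eccentricity_def hop_dist_root cong: image_cong)

lemma children_eq_K:
  assumes "x \<in> V"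
  shows "children (with_proj G) c x = K x"
proof -
  have "hop_dist (with_proj G) c y = hop_dist (with_proj G) c x + 1 \<longleftrightarrow> y \<noteq> c \<and> f y = x"
    if "(x, y) \<in> parcs G" for y
  proof -
    have "y \<in> V" using that edge_in by blast
    then have "hop_dist (with_proj G) c y = hop_dist (with_proj G) c x + 1 \<longleftrightarrow> ereal (real (d y)) = ereal (real (Suc (d x)))"
      using assms by (simp add: hop_dist_root one_ereal_def add.commute)
    also have "\<dots> \<longleftrightarrow> d y = Suc (d x)" by (simp del: of_nat_Suc)
    also have "\<dots> \<longleftrightarrow> y \<noteq> c \<and> f y = x" 
      using that
    proof (cases rule: edge_cases)
      case 2
      then show ?thesis by auto
    next
      case 1
      then have "f y \<noteq> x" if "y \<noteq> c" using that depth_parent[OF \<open>y \<in> V\<close> that] by auto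
      with 1 show ?thesis by auto
    qed
    finally show ?thesis .
  qed
  then show ?thesis by (auto simp: children_def K_iff edge_iff dest: parent_in)
qed

lemma branch_partition_eq:
  "branch_partition (with_proj G) c = {#card (K x) + 1. x \<in># mset_set (K c)#}"
  unfolding branch_partition_def children_eq_K[OF root_in]
  by (intro image_mset_cong) (auto simp: children_eq_K K_iff)

text \<open>The iteration stops one step before the root, at the neighbour of \<open>c\<close> whose
  branch contains \<open>v\<close>. Truncated subtraction yields the junk value \<open>c\<close> at
  the root itself, so the root is excluded where branches are compared.\<close>

definition branch_of where "branch_of v = (f ^^ (d v - 1)) v"

lemma branch_of_kid: "v \<in> K c \<Longrightarrow> branch_of v = v"
  using depth_K[of v c] by (simp add: branch_of_def depth_root)

lemma branch_of_parent:
  assumes "v \<in> V" "v \<noteq> c" "f v \<noteq> c"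
  shows "branch_of (f v) = branch_of v"
proof -
  have "d v = Suc (d (f v))" "d (f v) \<noteq> 0"
    using assms depth_parent depth_0_iff parent_in by blast+
  then obtain n where "d v = Suc (Suc n)" "d (f v) = Suc n" by (auto simp: gr0_conv_Suc)
  then show ?thesis by (simp add: branch_of_def funpow_swap1)
qed

lemma branch_of_edge:
  assumes "(x, y) \<in> parcs G" "x \<noteq> c" "y \<noteq> c"
  shows "branch_of x = branch_of y"
  using assms edge_in[OF assms(1)] branch_of_parent unfolding edge_iff by metis

text \<open>Here the descent stops just short of \<open>c\<close>. It therefore stays inside one
  branch, which makes descents from different branches disjoint.\<close>

lemma ex_chain_branch:
  assumes "v \<in> V" "v \<noteq> c"
  shows "\<exists>xs. vwalk xs (with_proj G) \<and> hd xs = v \<and> last xs = branch_of v \<and> length xs = d v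
    \<and> sorted_wrt (\<lambda>x y. d y < d x) xs \<and> set xs \<subseteq> {x \<in> V - {c}. branch_of x = branch_of v} \<and> branch_of v \<in> K c"
  using assms
proof (induction "d v" arbitrary: v)
  case 0
  then show ?case using depth_0_iff by auto
next
  case (Suc n)
  then have v: "f v \<in> V" "d v = Suc (d (f v))"
    using parent_in depth_parent by blast+
  show ?case
  proof (cases "f v = c")
    case True
    then have "v \<in> K c" using Suc.prems by (auto simp: K_iff)
    then show ?thesis using branch_of_kid Suc.prems depth_K depth_root by (intro exI[of _ "[v]"]) auto
  next
    case False
    have "n = d (f v)" using Suc.hyps(2) v by simp
    from Suc.hyps(1)[OF this v(1) False] obtain xs where xs: "vwalk xs (with_proj G)" "hd xs = f v" "last xs = branch_of (f v)"
      "length xs = d (f v)" "sorted_wrt (\<lambda>x y. d y < d x) xs" 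
      "set xs \<subseteq> {x \<in> V - {c}. branch_of x = branch_of (f v)}" "branch_of (f v) \<in> K c" by blast
    then obtain ys where "xs = f v # ys" by (cases xs) auto
    then have "vwalk (v # xs) (with_proj G)" "sorted_wrt (\<lambda>x y. d y < d x) (v # xs)"
      using v edge_parent[OF Suc.prems] xs by (auto simp: vwalk_Cons_iff)
    then show ?thesis using v Suc.prems xs branch_of_parent[OF Suc.prems False] \<open>xs = f v # ys\<close>
      by (intro exI[of _ "v # xs"]) auto
  qed
qed

lemma branch_of_in_kids: "v \<in> V \<Longrightarrow> v \<noteq> c \<Longrightarrow> branch_of v \<in> K c"
  using ex_chain_branch by blast

text \<open>The path descends from \<open>u\<close>, passes through \<open>c\<close> and follows the
  other descent in reverse. The two halves are disjoint because \<open>branch_of\<close> takes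
  different values on them.\<close>

lemma path_through_root:
  assumes "u \<in> V" "u \<noteq> c" "w \<in> V" "w \<noteq> c" "branch_of u \<noteq> branch_of w"
  shows "\<exists>xs. vwalk xs (with_proj G) \<and> distinct xs \<and> length xs = d u + d w + 1"
proof -
  obtain xs where xs: "vwalk xs (with_proj G)" "last xs = branch_of u" "length xs = d u"
    "sorted_wrt (\<lambda>x y. d y < d x) xs" "set xs \<subseteq> {x \<in> V - {c}. branch_of x = branch_of u}" "branch_of u \<in> K c"
    using ex_chain_branch[OF assms(1,2)] by auto
  obtain ys where ys: "vwalk ys (with_proj G)" "last ys = branch_of w" "length ys = d w"
    "sorted_wrt (\<lambda>x y. d y < d x) ys" "set ys \<subseteq> {x \<in> V - {c}. branch_of x = branch_of w}" "branch_of w \<in> K c"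
    using ex_chain_branch[OF assms(3,4)] by auto
  have "vwalk (c # rev ys) (with_proj G)"
    using vwalk_append[of "[c]" "with_proj G" "rev ys"] vwalk_rev_ex[OF symmetric_G ys(1)] ys root_in edge_parent
    by (auto simp: hd_rev K_iff)
  then have "vwalk (xs @ c # rev ys) (with_proj G)"
    using vwalk_append[OF xs(1)] xs edge_parent by (auto simp: K_iff)
  moreover have "set xs \<inter> set ys = {}" using xs(5) ys(5) assms(5) by fastforce
  then have "distinct (xs @ c # rev ys)"
    using xs(4,5) ys(4,5) strictly_decreasing_distinct[of d] by auto
  ultimately show ?thesis using xs(3) ys(3) by (intro exI[of _ "xs @ c # rev ys"]) auto
qed

lemma hop_dist_other_branch:
  assumes "u \<in> V" "u \<noteq> c" "w \<in> V" "w \<noteq> c" "branch_of u \<noteq> branch_of w"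
  shows "ereal (d u + d w) \<le> hop_dist (with_proj G) u w"
proof -
  \<comment> \<open>The depth, counted negatively outside the branch of \<open>w\<close>, changes by one along every edge.\<close>
  define \<phi> where "\<phi> x = (if x \<noteq> c \<and> branch_of x = branch_of w then int (d x) else - int (d x))" for x
  have "ereal (\<phi> w - \<phi> u) \<le> hop_dist (with_proj G) u w"
  proof (rule hop_dist_ge[OF wf_G])
    fix x y assume e: "(x, y) \<in> parcs G"
    have "d y = Suc (d x) \<or> d x = Suc (d y)" using e by (cases rule: edge_cases) auto
    moreover have "x = c \<longrightarrow> d x = 0" "y = c \<longrightarrow> d y = 0" using depth_root by auto
    ultimately show "\<phi> y \<le> \<phi> x + 1" using branch_of_edge[OF e]
      unfolding \<phi>_def by (cases "x = c"; cases "y = c") auto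
  qed
  then show ?thesis using assms by (simp add: \<phi>_def add.commute)
qed

end

section \<open>Branches at the root\<close>

context rooted_tree
begin

definition branch_verts where "branch_verts r = {v \<in> V - {c}. branch_of v = r}"

lemma branch_of_K:
  assumes "y \<in> K x" "x \<noteq> c"
  shows "branch_of y = branch_of x"
  using assms branch_of_parent[of y] by (auto simp: K_iff)

lemma K_subset_D: "x \<in> branch_verts r \<Longrightarrow> y \<in> K x \<Longrightarrow> y \<in> branch_verts r"
  using branch_of_K[of y x] by (auto simp: branch_verts_def K_iff)

lemma parent_in_D:
  assumes "v \<in> branch_verts r" "v \<noteq> r"
  shows "f v \<in> branch_verts r" "d v - 1 = Suc (d (f v) - 1)"
proof -
  have v: "v \<in> V" "v \<noteq> c" "branch_of v = r" using assms(1) by (auto simp: branch_verts_def)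
  moreover have "f v \<noteq> c" using v assms(2) branch_of_kid[of v] by (auto simp: K_iff)
  ultimately show "f v \<in> branch_verts r" using parent_in[of v] branch_of_parent[of v] by (auto simp: branch_verts_def)
  have "d (f v) \<noteq> 0" using v \<open>f v \<noteq> c\<close> depth_0_iff parent_in by blast
  then show "d v - 1 = Suc (d (f v) - 1)" using depth_parent[OF v(1,2)] by simp
qed

lemma kid_in_D: "r \<in> K c \<Longrightarrow> r \<in> branch_verts r"
  by (simp add: branch_verts_def branch_of_kid) (simp add: K_iff)

text \<open>A branch is again a rooted tree with the same parent function and depths lowered by one,
  so every result of the locale applies to it. The parent \<open>c\<close> of \<open>r\<close> lies
  outside the branch, which the axioms permit for a root.\<close>

lemma rooted_tree_D:
  assumes "r \<in> K c"
  shows "rooted_tree (branch_verts r) r f (\<lambda>v. d v - 1)"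
proof
  show "finite (branch_verts r)" using finite_V by (simp add: branch_verts_def)
  show "d r - 1 = 0" using depth_K[OF assms] depth_root by simp
qed (use kid_in_D[OF assms] parent_in_D in auto)

lemma kids_D:
  assumes "r \<in> K c" "x \<in> branch_verts r"
  shows "kids (branch_verts r) r f x = K x"
proof -
  have "r \<notin> K x"
    using assms by (auto simp: K_iff branch_verts_def)
  then show ?thesis
    using K_subset_D[OF assms(2)] by (auto simp: kids_def branch_verts_def)
qed

section \<open>Branches as components of the tree without its root\<close>

abbreviation "H \<equiv> pre_digraph.del_vert (with_proj G) c"

lemma wf_H: "wf_digraph H"
  by (rule wf_digraph.wf_digraph_del_vert[OF wf_G])

lemma arcs_ends_H: "arcs_ends H = {(x, y) \<in> parcs G. x \<noteq> c \<and> y \<noteq> c}"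
  by (auto simp: arcs_ends_conv pre_digraph.del_vert_simps)

lemma induce_D:
  assumes "r \<in> K c"
  shows "H \<restriction> branch_verts r = with_proj (tree_graph (branch_verts r) r f)"
proof -
  interpret R: rooted_tree "branch_verts r" r f "\<lambda>v. d v - 1" by (rule rooted_tree_D[OF assms])
  have "(x, y) \<in> parcs G \<and> x \<in> branch_verts r \<and> y \<in> branch_verts r \<longleftrightarrow> (x, y) \<in> parcs (tree_graph (branch_verts r) r f)" for x y
  proof
    assume *: "(x, y) \<in> parcs G \<and> x \<in> branch_verts r \<and> y \<in> branch_verts r"
    then have "f r \<noteq> x" "f r \<noteq> y" using assms by (auto simp: K_iff branch_verts_def)
    then show "(x, y) \<in> parcs (tree_graph (branch_verts r) r f)"
      using * unfolding edge_iff R.edge_iff by auto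
  next
    assume *: "(x, y) \<in> parcs (tree_graph (branch_verts r) r f)"
    then show "(x, y) \<in> parcs G \<and> x \<in> branch_verts r \<and> y \<in> branch_verts r"
      using R.edge_in[OF *] unfolding edge_iff R.edge_iff by (auto simp: branch_verts_def)
  qed
  then have "{e \<in> arcs H. tail H e \<in> branch_verts r \<and> head H e \<in> branch_verts r} = parcs (tree_graph (branch_verts r) r f)"
    by (auto simp: pre_digraph.del_vert_simps) (auto simp: branch_verts_def)
  then show ?thesis
    by (intro pre_digraph.equality) (simp_all add: pre_digraph.del_vert_simps)
qed

lemma reachable_H_branch_of:
  assumes "x \<rightarrow>\<^sup>*\<^bsub>H\<^esub> y"
  shows "branch_of y = branch_of x"
  using assms
  by (rule wf_digraph.reachable_induct[OF wf_H]) (auto simp: arcs_ends_H dest: branch_of_edge)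

text \<open>A branch is connected because it is a rooted tree sitting in \<open>H\<close> as an
  induced subgraph. It is maximal because, with \<open>c\<close> removed, no edge changes the value
  of \<open>branch_of\<close>.\<close>

lemma D_in_sccs_verts:
  assumes "r \<in> K c"
  shows "branch_verts r \<in> pre_digraph.sccs_verts H"
proof -
  interpret H: wf_digraph H by (rule wf_H)
  interpret R: rooted_tree "branch_verts r" r f "\<lambda>v. d v - 1" by (rule rooted_tree_D[OF assms])
  have "induced_subgraph (H \<restriction> branch_verts r) H"
    by (rule H.induced_induce) (auto simp: branch_verts_def pre_digraph.del_vert_simps)
  then have sub: "subgraph (with_proj R.G) H" by (simp add: induce_D[OF assms] induced_imp_subgraph)
  have "x \<rightarrow>\<^sup>*\<^bsub>H\<^esub> y" if "x \<in> branch_verts r" "y \<in> branch_verts r" for x y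
  proof (rule pre_digraph.reachable_mono[OF _ sub])
    show "x \<rightarrow>\<^sup>*\<^bsub>with_proj R.G\<^esub> y"
      using that R.strongly_connected_G by (simp add: strongly_connected_def)
  qed
  moreover have "y \<in> branch_verts r" if "x \<in> branch_verts r" "x \<rightarrow>\<^sup>*\<^bsub>H\<^esub> y" for x y
    using that reachable_H_branch_of[OF that(2)] H.reachable_in_verts(2)[OF that(2)]
    by (auto simp: branch_verts_def pre_digraph.del_vert_simps)
  ultimately show ?thesis
    using kid_in_D[OF assms] unfolding pre_digraph.sccs_verts_def by blast
qed

lemma sccs_verts_H: "pre_digraph.sccs_verts H = branch_verts ` K c"
proof (intro equalityI subsetI)
  interpret H: wf_digraph H by (rule wf_H)
  fix S assume S: "S \<in> H.sccs_verts"
  then obtain v where v: "v \<in> S" by (auto simp: H.in_sccs_verts_conv_reachable)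
  with S have "v \<in> V" "v \<noteq> c"
    using H.sccs_verts_subsets[OF S] by (auto simp: pre_digraph.del_vert_simps)
  then have "branch_of v \<in> K c" "v \<in> branch_verts (branch_of v)" using branch_of_in_kids by (auto simp: branch_verts_def)
  \<comment> \<open>Components are disjoint or equal, and \<open>S\<close> shares \<open>v\<close>
    with the branch of \<open>v\<close>.\<close>
  then show "S \<in> branch_verts ` K c"
    using H.sccs_verts_disjoint[OF S D_in_sccs_verts] v by blast
qed (use D_in_sccs_verts in auto)

lemma branches_eq: "branches (with_proj G) c = (\<lambda>r. with_proj (tree_graph (branch_verts r) r f)) ` K c"
  unfolding branches_def wf_digraph.sccs_conv_sccs_verts[OF wf_H] sccs_verts_H
  by (auto simp: induce_D image_image)

text \<open>\<open>tree_code\<close> ranges over the set of branches. Injectivity turns this into a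
  multiset indexed by the children of the root without merging any members.\<close>

lemma inj_branch: "inj_on (\<lambda>r. with_proj (tree_graph (branch_verts r) r f)) (K c)"
proof (rule inj_onI)
  fix r s assume r: "r \<in> K c" and "s \<in> K c"
    and "with_proj (tree_graph (branch_verts r) r f) = with_proj (tree_graph (branch_verts s) s f)"
  then have "branch_verts r = branch_verts s" by (metis with_proj_simps(1) rooted_tree.pverts_G rooted_tree_D)
  then show "r = s" using kid_in_D[OF r] branch_of_kid[OF r] by (auto simp: branch_verts_def)
qed

lemma branch_root_unique:
  assumes "r \<in> K c"
  shows "x \<in> branch_verts r \<and> (c, x) \<in> parcs G \<longleftrightarrow> x = r"
proof -
  have "(c, x) \<in> parcs G \<longleftrightarrow> x \<in> K c" by (auto simp: edge_iff K_iff)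
  then show ?thesis using assms kid_in_D[OF assms] branch_of_kid[of x] by (auto simp: branch_verts_def)
qed

lemma branch_root_eq:
  assumes "r \<in> K c"
  shows "branch_root (with_proj G) c (with_proj (tree_graph (branch_verts r) r f)) = r"
  using branch_root_unique[OF assms] rooted_tree.pverts_G[OF rooted_tree_D[OF assms]]
  by (simp add: branch_root_def)

lemma branch_partition_D:
  assumes "r \<in> K c"
  shows "branch_partition (with_proj (tree_graph (branch_verts r) r f)) r = {#card (K x) + 1. x \<in># mset_set (K r)#}"
proof -
  interpret R: rooted_tree "branch_verts r" r f "\<lambda>v. d v - 1" by (rule rooted_tree_D[OF assms])
  show ?thesis
    unfolding R.branch_partition_eq kids_D[OF assms kid_in_D[OF assms]]
    using kids_D[OF assms] K_subset_D[OF kid_in_D[OF assms]] by (intro image_mset_cong) auto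
qed

text \<open>This concerns an arbitrary rooted tree. That \<open>c\<close> is the centre enters only
  with diameter six.\<close>

lemma code_at_root:
  "{#branch_partition B (branch_root (with_proj G) c B). B \<in># mset_set (branches (with_proj G) c)#}
     = nested_code V c f"
proof -
  have "mset_set (branches (with_proj G) c)
      = {#with_proj (tree_graph (branch_verts r) r f). r \<in># mset_set (K c)#}"
    unfolding branches_eq by (rule image_mset_mset_set[OF inj_branch, symmetric])
  then show ?thesis
    unfolding nested_code_def
    by (auto simp: multiset.map_comp branch_root_eq branch_partition_D intro!: image_mset_cong)
qed

end

section \<open>Depth three in two branches\<close>

text \<open>The root plays the role of the midpoint of a longest path, with \<open>u\<close> and
  \<open>w\<close> as its ends.\<close>

locale diam6_tree = rooted_tree +
  fixes u w
  assumes depth_le: "v \<in> V \<Longrightarrow> d v \<le> 3"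
    and far: "u \<in> V" "w \<in> V" "d u = 3" "d w = 3" "branch_of u \<noteq> branch_of w"
begin

text \<open>Depths of at most three allow at most seven vertices on a path, and the path from
  \<open>u\<close> to \<open>w\<close> through the root has exactly seven.\<close>

lemma diameter_G: "diameter (with_proj G) = 6"
proof -
  have 1: "length xs - 1 \<le> 6" if "vwalk xs (with_proj G)" "distinct xs" for xs
  proof -
    have "xs \<noteq> []" "set xs \<subseteq> V" using that(1) by (simp_all add: vwalk_def)
    then have "d (hd xs) \<le> 3" "d (last xs) \<le> 3"
      using depth_le hd_in_set last_in_set by blast+
    then show ?thesis using reduced_length_le[OF that(1) distinct_reduced[OF that(2)]] by simp
  qed
  have "u \<noteq> c" "w \<noteq> c" using far depth_root by auto
  then obtain xs where xs: "vwalk xs (with_proj G)" "distinct xs" "length xs = 7"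
    using path_through_root[of u w] far by auto
  show ?thesis unfolding diameter_def apath_lengths_eq[OF wf_G]
  proof (rule Max_eqI)
    have "{length xs - 1 |xs. vwalk xs (with_proj G) \<and> distinct xs} \<subseteq> {..6}" using 1 by auto
    then show "finite {length xs - 1 |xs. vwalk xs (with_proj G) \<and> distinct xs}"
      by (rule finite_subset) simp
  next
    show "6 \<in> {length xs - 1 |xs. vwalk xs (with_proj G) \<and> distinct xs}"
      using xs by (intro CollectI exI[of _ xs]) simp
  qed (use 1 in auto)
qed

lemma G_in_diam6_trees: "G \<in> diam6_trees"
  using undirected_tree_G diameter_G by (simp add: diam6_trees_def)

lemma eccentricity_root_le: "eccentricity (with_proj G) c \<le> ereal 3"
  unfolding eccentricity_root using finite_V root_in depth_le by (intro Max.boundedI) auto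

text \<open>At least one of \<open>u\<close> and \<open>w\<close> lies in another branch than
  \<open>v\<close>, hence at distance at least \<open>d v + 3\<close>.\<close>

lemma eccentricity_other:
  assumes "v \<in> V" "v \<noteq> c"
  shows "ereal 4 \<le> eccentricity (with_proj G) v"
proof -
  obtain z where z: "z \<in> V" "d z = 3" "branch_of v \<noteq> branch_of z" using far by metis
  moreover have "z \<noteq> c" using z depth_root by auto
  moreover have "d v \<noteq> 0" using assms depth_0_iff by auto
  ultimately have "ereal 4 \<le> hop_dist (with_proj G) v z"
    using hop_dist_other_branch[OF assms, of z] by (intro order_trans[OF _ hop_dist_other_branch[OF assms]]) auto
  also have "\<dots> \<le> eccentricity (with_proj G) v"
    unfolding eccentricity_def using finite_V z by (intro Max_ge) auto
  finally show ?thesis .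
qed

lemma central_iff: "central_vertex (with_proj G) x \<longleftrightarrow> x = c"
proof -
  have less: "eccentricity (with_proj G) c < eccentricity (with_proj G) v" if "v \<in> V" "v \<noteq> c" for v
  proof -
    note eccentricity_root_le
    also have "ereal 3 < ereal 4" by simp
    also note eccentricity_other[OF that]
    finally show ?thesis .
  qed
  then show ?thesis
    using root_in unfolding central_vertex_def is_arg_min_def
    by (auto dest: less_asym)
qed

lemma center_G: "center (with_proj G) = c"
  by (simp add: center_def central_iff)

lemma diam6_code_G: "diam6_code G = nested_code V c f"
  unfolding diam6_code_def tree_code_def center_G by (rule code_at_root)

lemma branch_structure:
  assumes "B \<in> branches (with_proj G) c"
  shows "\<exists>!r. r \<in> verts B \<and> (c, r) \<in> arcs_ends (with_proj G)"
    "r \<in> verts B \<Longrightarrow> (c, r) \<in> arcs_ends (with_proj G) \<Longrightarrow> height B r \<le> 2"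
    "r \<in> verts B \<Longrightarrow> (c, r) \<in> arcs_ends (with_proj G) \<Longrightarrow> x \<in> children B r r \<Longrightarrow>
      y \<in> children B r x \<Longrightarrow> children B r y = {}"
proof -
  obtain s where s: "s \<in> K c" and B: "B = with_proj (tree_graph (branch_verts s) s f)"
    using assms by (auto simp: branches_eq)
  interpret R: rooted_tree "branch_verts s" s f "\<lambda>v. d v - 1" by (rule rooted_tree_D[OF s])
  have r: "r \<in> verts B \<and> (c, r) \<in> arcs_ends (with_proj G) \<longleftrightarrow> r = s" for r
    using branch_root_unique[OF s] B by simp
  then show "\<exists>!r. r \<in> verts B \<and> (c, r) \<in> arcs_ends (with_proj G)" by simp
  have "ereal (d v - 1) \<le> 2" if "v \<in> branch_verts s" for v
  proof -
    have "d v - 1 \<le> 2" using depth_le[of v] that by (auto simp: branch_verts_def)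
    then have "ereal (real (d v - 1)) \<le> ereal (real 2)" by (simp only: ereal_less_eq of_nat_le_iff)
    then show ?thesis by simp
  qed
  then show "height B r \<le> 2" if "r \<in> verts B" "(c, r) \<in> arcs_ends (with_proj G)"
  proof -
    have "eccentricity (with_proj R.G) s \<le> 2"
      using \<open>\<And>v. v \<in> branch_verts s \<Longrightarrow> ereal (d v - 1) \<le> 2\<close> R.finite_V R.root_in
      unfolding R.eccentricity_root by (intro Max.boundedI) auto
    moreover have "r = s" using that r by blast
    ultimately show ?thesis by (simp add: height_def B)
  qed
  show "children B r y = {}" if "r \<in> verts B" "(c, r) \<in> arcs_ends (with_proj G)"
    "x \<in> children B r r" "y \<in> children B r x"
  proof -
    have "r = s" using that r by blast
    then have x: "x \<in> branch_verts s" "x \<in> K s" "r = s"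
      using that kids_D[OF s kid_in_D[OF s]] K_subset_D[OF kid_in_D[OF s]]
      by (auto simp: B R.children_eq_K[OF R.root_in])
    then have y: "y \<in> branch_verts s" "y \<in> K x"
      using that kids_D[OF s] K_subset_D[of x s] by (auto simp: B R.children_eq_K)
    \<comment> \<open>The depth is measured in the whole tree, where the branch root has depth one.
      A child of \<open>y\<close> would exceed depth three.\<close>
    have "d y = 3" using depth_K[OF s] depth_K[OF x(2)] depth_K[OF y(2)] depth_root by simp
    then have "K y = {}" using depth_K[of _ y] depth_le by (fastforce simp: K_iff)
    then show ?thesis using x y kids_D[OF s y(1)] by (simp add: B R.children_eq_K)
  qed
qed

lemma sum_UN_K:
  assumes "finite A"
  shows "sum g (\<Union>x\<in>A. K x) = (\<Sum>x\<in>A. \<Sum>y\<in>K x. g y)"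
  using assms by (intro sum.UNION_disjoint) (auto simp: K_iff)

lemma level_Suc: "{v \<in> V. d v = Suc n} = (\<Union>x\<in>{v \<in> V. d v = n}. K x)"
proof (intro equalityI subsetI)
  fix v assume "v \<in> {v \<in> V. d v = Suc n}"
  moreover from this have "v \<noteq> c" using depth_root by auto
  ultimately show "v \<in> (\<Union>x\<in>{v \<in> V. d v = n}. K x)"
    using parent_in[of v] depth_parent[of v] by (auto simp: K_iff)
qed (use depth_K in \<open>auto simp: K_iff\<close>)

lemma card_level_Suc: "card {v \<in> V. d v = Suc n} = (\<Sum>x\<in>{v \<in> V. d v = n}. card (K x))"
  using sum_UN_K[of "{v \<in> V. d v = n}" "\<lambda>_. 1 :: nat"] finite_V by (simp add: level_Suc)

text \<open>The vertices are counted by depth and then regrouped by branch. The summand 1 of a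
  branch counts its root, and each part counts a child of that root together with the leaves below
  it.\<close>

lemma card_V: "card V = 1 + (\<Sum>\<pi> \<in># diam6_code G. 1 + sum_mset \<pi>)"
proof -
  have L0: "{v \<in> V. d v = 0} = {c}" using depth_0_iff root_in by auto
  then have L1: "{v \<in> V. d v = 1} = K c" using level_Suc[of 0] by simp
  then have L2: "{v \<in> V. d v = 2} = (\<Union>r\<in>K c. K r)" using level_Suc[of 1] by (simp add: numeral_2_eq_2)
  have "V = (\<Union>n\<in>{..3}. {v \<in> V. d v = n})" using depth_le by auto
  then have "card V = card (\<Union>n\<in>{..3}. {v \<in> V. d v = n})" by simp
  also have "\<dots> = (\<Sum>n\<le>3. card {v \<in> V. d v = n})"
    using finite_V by (intro card_UN_disjoint) auto
  also have "\<dots> = 1 + card (K c) + (\<Sum>r\<in>K c. card (K r)) + (\<Sum>x\<in>(\<Union>r\<in>K c. K r). card (K x))"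
    using card_level_Suc[of 1] card_level_Suc[of 2] L0 L1 L2 by (simp add: numeral_eq_Suc)
  also have "\<dots> = 1 + (\<Sum>r\<in>K c. 1 + (\<Sum>x\<in>K r. card (K x) + 1))"
    by (simp add: sum_UN_K sum.distrib sum_Suc)
  also have "\<dots> = 1 + (\<Sum>\<pi> \<in># nested_code V c f. 1 + sum_mset \<pi>)"
    by (simp add: nested_code_def multiset.map_comp comp_def sum_unfold_sum_mset)
  finally show ?thesis by (simp add: diam6_code_G)
qed

text \<open>The parent of a vertex of depth three gives a part of at least two. The vertices
  \<open>u\<close> and \<open>w\<close> supply two such branches; counting branch roots rather than
  partitions respects multiplicity if the two partitions are equal.\<close>

lemma code_admissible: "diam6_code G \<in> admissible_codes"
proof -
  define P where "P \<pi> \<longleftrightarrow> (\<exists>q \<in># \<pi>. 2 \<le> q)" for \<pi> :: "nat multiset"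
  define h where "h r = {#card (K x) + 1. x \<in># mset_set (K r)#}" for r
  have long: "branch_of v \<in> {r \<in> K c. P (h r)}" if "v \<in> V" "d v = 3" for v
  proof -
    have v: "v \<noteq> c" using that depth_root by auto
    then have fv: "f v \<in> V" "d (f v) = 2" using that depth_parent[of v] parent_in by auto
    then have "f v \<noteq> c" using depth_root by auto
    moreover have "branch_of v = f (f v)" using that by (simp add: branch_of_def numeral_eq_Suc)
    ultimately have "f v \<in> K (branch_of v)" using fv by (simp add: K_iff)
    moreover have "v \<in> K (f v)" using that v by (simp add: K_iff)
    then have "2 \<le> card (K (f v)) + 1" using finite_K[of "f v"] by (cases "card (K (f v))") auto
    ultimately show ?thesis
      using branch_of_in_kids[OF that(1) v] finite_K by (auto simp: P_def h_def)
  qed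
  have "{branch_of u, branch_of w} \<subseteq> {r \<in> K c. P (h r)}" using long far by blast
  then have "card {branch_of u, branch_of w} \<le> card {r \<in> K c. P (h r)}"
    by (rule card_mono[rotated]) (simp add: finite_K)
  moreover have "size (filter_mset P (image_mset h (mset_set (K c)))) = card {r \<in> K c. P (h r)}"
    by (simp add: filter_mset_image_mset filter_mset_mset_set)
  moreover have "nested_code V c f = image_mset h (mset_set (K c))"
    unfolding nested_code_def h_def[abs_def] ..
  ultimately have "2 \<le> size (filter_mset P (nested_code V c f))"
    using far by simp
  then show ?thesis
    unfolding diam6_code_G
    by (auto simp: admissible_codes_def P_def[abs_def] nested_code_def integer_partition_def)
qed

end

section \<open>Every tree of diameter six arises this way\<close>

text \<open>By induction the tail is distinct, so if the head recurs, the segment up to its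
  recurrence is a closed walk with distinct tail. Absence of loops and of backtracking gives it at
  least three edges, so it is a forbidden cycle.\<close>

lemma acyclic_reduced_distinct:
  assumes tree: "undirected_tree (with_proj T)"
    and "vwalk xs (with_proj T)" "reduced xs"
  shows "distinct xs"
  using assms(2,3)
proof (induction xs rule: list.induct)
  case (Cons x ys)
  interpret pair_graph T
    using tree by (intro pair_graphI_graph) (simp add: undirected_tree_def)
  have wf: "wf_digraph (with_proj T)" by unfold_locales
  show ?case
  proof (cases "ys = []")
    case False
    then have "distinct ys"
      using Cons.IH Cons.prems reduced_ConsD by (meson vwalk_consE)
    moreover have "x \<notin> set ys"
    proof
      assume "x \<in> set ys"
      then obtain as bs where ys: "ys = as @ x # bs" by (meson split_list)
      then have walk: "vwalk (x # as @ [x]) (with_proj T)"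
        using Cons.prems(1) vwalkI_append_l[of "x # as @ [x]" bs] by simp
      have "as \<noteq> []" using walk no_loops'[of x x] by (auto simp: vwalk_def)
      moreover have "length as \<noteq> 1" using Cons.prems(2) ys by (auto simp: length_Suc_conv)
      ultimately have "4 \<le> length (x # as @ [x])" by (cases as) (auto simp: Suc_le_eq)
      moreover have "distinct (tl (x # as @ [x]))" using \<open>distinct ys\<close> ys by auto
      ultimately have "\<exists>xs. vwalk xs (with_proj T) \<and> hd xs = last xs \<and> distinct (tl xs) \<and> 4 \<le> length xs"
        using walk by (intro exI[of _ "x # as @ [x]"]) auto
      then show False using tree ex_cycle_iff[OF wf] by (auto simp: undirected_tree_def)
    qed
    ultimately show ?thesis by simp
  qed simp
qed simp

lemma undirected_tree_rooted:
  assumes tree: "undirected_tree (with_proj T)" and c: "c \<in> pverts T"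
  obtains f d where "rooted_tree (pverts T) c f d" "T = tree_graph (pverts T) c f"
proof -
  interpret pair_graph T
    using tree by (intro pair_graphI_graph) (simp add: undirected_tree_def)
  have "strongly_connected (with_proj T)"
    using tree sym_arcs by (intro symmetric_connected_imp_strongly_connected) (auto simp: undirected_tree_def)
  then have reach: "\<exists>n. (c, v) \<in> parcs T ^^ n" if "v \<in> pverts T" for v
    using that c reachable_rtranclI[of "with_proj T" c v] by (auto simp: strongly_connected_def rtrancl_is_UN_relpow)
  \<comment> \<open>The relation power makes \<open>d\<close> the breadth-first distance from
    \<open>c\<close>; \<open>f\<close> below picks any neighbour one step closer.\<close>
  define d where "d v = (LEAST n. (c, v) \<in> parcs T ^^ n)" for v
  have d_le: "d v \<le> n" if "(c, v) \<in> parcs T ^^ n" for v n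
    unfolding d_def using that by (rule Least_le)
  have d: "(c, v) \<in> parcs T ^^ d v" if "v \<in> pverts T" for v
    unfolding d_def using reach[OF that] by (rule LeastI_ex)
  have ex_parent: "\<exists>w. (w, v) \<in> parcs T \<and> d v = Suc (d w)" if "v \<in> pverts T" "v \<noteq> c" for v
  proof (cases "d v")
    case 0
    then show ?thesis using d[OF that(1)] that(2) by simp
  next
    case (Suc n)
    then have "(c, v) \<in> parcs T ^^ Suc n" using d[OF that(1)] by simp
    then obtain w where w: "(c, w) \<in> parcs T ^^ n" "(w, v) \<in> parcs T" by auto
    have "(c, w) \<in> parcs T ^^ d w" using d w(2) in_arcsD1 by blast
    then have "d v \<le> Suc (d w)" using w(2) by (intro d_le) auto
    then show ?thesis using w d_le[OF w(1)] Suc by auto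
  qed
  define f where "f v = (SOME w. (w, v) \<in> parcs T \<and> d v = Suc (d w))" for v
  have f: "(f v, v) \<in> parcs T" "d v = Suc (d (f v))" if "v \<in> pverts T" "v \<noteq> c" for v
    unfolding f_def using someI_ex[OF ex_parent[OF that]] by auto
  interpret R: rooted_tree "pverts T" c f d
  proof
    show "finite (pverts T)" by simp
    show "d c = 0" using d_le[of c 0] by simp
    show "f v \<in> pverts T" if "v \<in> pverts T" "v \<noteq> c" for v using f(1)[OF that] in_arcsD1 by blast
  qed (use c f in auto)
  have sub: "parcs R.G \<subseteq> parcs T"
    using f arcs_symmetric by (auto simp: tree_graph_def)
  then have mono: "vwalk xs (with_proj T)" if "vwalk xs (with_proj R.G)" for xs
    using that by (auto simp: vwalk_def)
  have "(x, y) \<in> parcs R.G" if xy: "(x, y) \<in> parcs T" for x y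
  proof (rule ccontr)
    assume no: "(x, y) \<notin> parcs R.G"
    have "x \<in> pverts T" "y \<in> pverts T" using xy in_arcsD1 in_arcsD2 by auto
    then obtain xs ys where
      xs: "vwalk (x # xs) (with_proj R.G)" "last (x # xs) = c" "length xs = d x"
        "sorted_wrt (\<lambda>x y. d y < d x) (x # xs)" "xs = [] \<or> hd xs = f x" and
      ys: "vwalk (y # ys) (with_proj R.G)" "last (y # ys) = c" "length ys = d y"
        "sorted_wrt (\<lambda>x y. d y < d x) (y # ys)" "ys = [] \<or> hd ys = f y"
      using R.ex_chain[of x] R.ex_chain[of y] by blast
    \<comment> \<open>The descents from \<open>x\<close> and \<open>y\<close>, joined by the extra
      edge, form a walk from \<open>c\<close> to \<open>c\<close>. It does not backtrack, since
      neither end of the edge is the parent of the other. Acyclicity makes it distinct, yet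
      \<open>c\<close> occurs in both halves.\<close>
    have "vwalk (rev (x # xs)) (with_proj T)"
      by (intro vwalk_rev_ex sym_arcs mono xs(1))
    then have "vwalk (rev (x # xs) @ (y # ys)) (with_proj T)"
      by (rule vwalk_append) (use xy mono ys(1) in auto)
    moreover have "reduced (rev xs @ x # y # ys)"
    proof (rule reduced_join)
      show "reduced (x # xs)" "reduced (y # ys)"
        using xs(4) ys(4) strictly_decreasing_distinct distinct_reduced by blast+
      show "xs = [] \<or> hd xs \<noteq> y" "ys = [] \<or> hd ys \<noteq> x"
        using xs(3,5) ys(3,5) no \<open>x \<in> pverts T\<close> \<open>y \<in> pverts T\<close> R.depth_root
        by (auto simp: R.edge_iff)
    qed
    ultimately have "distinct (rev (x # xs) @ (y # ys))"
      using acyclic_reduced_distinct[OF tree, of "rev xs @ x # y # ys"] by simp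
    moreover have "c \<in> set (x # xs)" "c \<in> set (y # ys)"
      using xs(2) ys(2) by (metis last_in_set list.distinct(1))+
    ultimately show False by auto
  qed
  then have "parcs T = parcs R.G" using sub by auto
  then have "T = R.G" by (intro pair_pre_digraph.equality) auto
  then show ?thesis using that R.rooted_tree_axioms by blast
qed

text \<open>A path that starts at the root moves away from it at every step: \<open>c\<close> is
  nobody's child, and each later vertex has already used the edge to its parent.\<close>

lemma (in rooted_tree) third_level:
  assumes "(c, x) \<in> parcs G" "(x, y) \<in> parcs G" "(y, z) \<in> parcs G" "distinct [c, x, y, z]"
  shows "z \<in> V" "d z = 3" "branch_of z = x"
proof -
  have "x \<noteq> c" "y \<noteq> c" "z \<noteq> c" "z \<noteq> x" using assms(4) by auto
  then have x: "x \<in> V" "x \<noteq> c" "f x = c" and y: "y \<in> V" "y \<noteq> c" "f y = x"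
    and z: "z \<in> V" "z \<noteq> c" "f z = y"
    using assms(1-3) unfolding edge_iff by metis+
  show "z \<in> V" by (rule z)
  show "d z = 3" using depth_parent[OF z(1,2)] depth_parent[OF y(1,2)] depth_parent[OF x(1,2)]
      depth_root x y z by simp
  then show "branch_of z = x" using x y z by (simp add: branch_of_def numeral_eq_Suc)
qed

lemma diam6_trees_rooted:
  assumes T: "T \<in> diam6_trees"
  obtains c f d u w where "diam6_tree (pverts T) c f d u w" "T = tree_graph (pverts T) c f"
proof -
  have tree: "undirected_tree (with_proj T)" and diam: "diameter (with_proj T) = 6"
    using T by (auto simp: diam6_trees_def)
  interpret pair_graph T
    using tree by (intro pair_graphI_graph) (simp add: undirected_tree_def)
  have wf: "wf_digraph (with_proj T)" by unfold_locales
  define P where "P = {length xs - 1 |xs. vwalk xs (with_proj T) \<and> distinct xs}"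
  \<comment> \<open>Paths have no more vertices than the graph, so the \<open>Max\<close> defining
    the diameter is over a finite set; the path with one vertex shows that the set is
    nonempty.\<close>
  have "length xs - 1 \<le> card (pverts T)" if "vwalk xs (with_proj T)" "distinct xs" for xs
  proof -
    have "length xs = card (set xs)" using that by (simp add: distinct_card)
    also have "\<dots> \<le> card (pverts T)" using that by (intro card_mono) (auto simp: vwalk_def)
    finally show ?thesis by simp
  qed
  then have "P \<subseteq> {..card (pverts T)}" by (auto simp: P_def)
  then have fin: "finite P" by (rule finite_subset) simp
  obtain v where "v \<in> pverts T"
    using tree by (auto simp: undirected_tree_def Digraph_Component.connected_def strongly_connected_def mk_symmetric_def)
  then have "length [v] - 1 \<in> P" unfolding P_def by (intro CollectI exI[of _ "[v]"]) auto
  moreover have Max: "Max P = 6" using diam unfolding diameter_def apath_lengths_eq[OF wf] P_def .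
  ultimately have "6 \<in> P" using Max_in[OF fin] by auto
  then obtain xs where xs: "vwalk xs (with_proj T)" "distinct xs" "length xs = 7"
    by (auto simp: P_def)
  then obtain p0 p1 p2 c p4 p5 p6 where p: "xs = [p0, p1, p2, c, p4, p5, p6]"
    by (auto simp: numeral_eq_Suc length_Suc_conv)
  then have "c \<in> pverts T" using xs(1) by (auto simp: vwalk_def)
  then obtain f d where R: "rooted_tree (pverts T) c f d" and eq: "T = tree_graph (pverts T) c f"
    using undirected_tree_rooted[OF tree] by metis
  interpret R: rooted_tree "pverts T" c f d by (rule R)
  have edges: "(p0, p1) \<in> parcs T" "(p1, p2) \<in> parcs T" "(p2, c) \<in> parcs T" "(c, p4) \<in> parcs T"
    "(p4, p5) \<in> parcs T" "(p5, p6) \<in> parcs T"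
    using xs(1) p by (auto simp: vwalk_def)
  have "p0 \<in> pverts T" "d p0 = 3" "R.branch_of p0 = p2"
    using R.third_level[of p2 p1 p0] edges arcs_symmetric xs(2) p eq[symmetric] by auto
  moreover have "p6 \<in> pverts T" "d p6 = 3" "R.branch_of p6 = p4"
    using R.third_level[of p4 p5 p6] edges xs(2) p eq[symmetric] by auto
  moreover have "p2 \<noteq> p4" using xs(2) p by auto
  ultimately have ends: "p0 \<in> pverts T" "p6 \<in> pverts T" "d p0 = 3" "d p6 = 3" "R.branch_of p0 \<noteq> R.branch_of p6" by auto
  have "diam6_tree (pverts T) c f d p0 p6"
  proof unfold_locales
    fix v assume v: "v \<in> pverts T"
    show "d v \<le> 3"
    proof (rule ccontr)
      assume "\<not> d v \<le> 3"
      then have "v \<noteq> c" using R.depth_root by auto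
      \<comment> \<open>One end of the longest path is in another branch than \<open>v\<close>.
        Joining it to \<open>v\<close> through \<open>c\<close> would give a path of at least seven
        edges.\<close>
      obtain z where z: "z \<in> pverts T" "d z = 3" "R.branch_of v \<noteq> R.branch_of z" using ends by metis
      then have "z \<noteq> c" using R.depth_root by auto
      then obtain ys where ys: "vwalk ys (with_proj T)" "distinct ys" "length ys = d v + d z + 1"
        using R.path_through_root[OF v \<open>v \<noteq> c\<close> z(1) _ z(3)] eq by auto
      then have "length ys - 1 \<in> P" unfolding P_def by blast
      then have "length ys - 1 \<le> 6" using Max_ge[OF fin] Max by auto
      then show False using ys z \<open>\<not> d v \<le> 3\<close> by auto
    qed
  qed (use ends in auto)
  then show ?thesis using that eq by blast
qed

section \<open>Codes and isomorphisms\<close>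

text \<open>This condition can be arranged one level at a time, and it already forces an isomorphism
  of rooted trees.\<close>

definition local_bij :: "('a \<Rightarrow> 'b) \<Rightarrow> 'a set \<Rightarrow> 'a \<Rightarrow> ('a \<Rightarrow> 'a) \<Rightarrow> 'b set \<Rightarrow> 'b \<Rightarrow> ('b \<Rightarrow> 'b) \<Rightarrow> bool" where
  "local_bij h V c f V' c' f' \<longleftrightarrow>
     h c = c' \<and> (\<forall>x\<in>V. bij_betw h (kids V c f x) (kids V' c' f' (h x)))"

locale rooted_trees_local_bij =
  R: rooted_tree V c f d + R': rooted_tree V' c' f' d'
  for V :: "'a set" and c f d and V' :: "'b set" and c' f' d' +
  fixes h
  assumes loc: "local_bij h V c f V' c' f'"
begin

lemma bij_K: "x \<in> V \<Longrightarrow> bij_betw h (R.K x) (R'.K (h x))"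
  using loc by (simp add: local_bij_def)

lemma h_root: "h c = c'"
  using loc by (simp add: local_bij_def)

lemma h_nonroot:
  assumes "v \<in> V" "v \<noteq> c"
  shows "h v \<in> V'" "h v \<noteq> c'" "f' (h v) = h (f v)"
proof -
  have "v \<in> R.K (f v)" using assms by (simp add: R.K_iff)
  then have "h v \<in> R'.K (h (f v))"
    using bij_K[OF R.parent_in[OF assms]] by (auto simp: bij_betw_def)
  then show "h v \<in> V'" "h v \<noteq> c'" "f' (h v) = h (f v)" by (auto simp: R'.K_iff)
qed

lemma h_in: "v \<in> V \<Longrightarrow> h v \<in> V'"
  using h_nonroot(1) h_root R'.root_in by (cases "v = c") auto

lemma depth_h: "v \<in> V \<Longrightarrow> d' (h v) = d v"
proof (induction "d v" arbitrary: v)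
  case 0
  then show ?case using R.depth_0_iff h_root R'.depth_root by auto
next
  case (Suc n)
  then have v: "v \<noteq> c" using R.depth_root by auto
  have "d v = Suc (d (f v))" "d' (h v) = Suc (d' (h (f v)))" "f v \<in> V"
    using R.depth_parent[OF Suc.prems v] R'.depth_parent[OF h_nonroot(1,2)[OF Suc.prems v]]
      h_nonroot(3)[OF Suc.prems v] R.parent_in[OF Suc.prems v] by auto
  then show ?case using Suc.hyps by simp
qed

text \<open>Vertices with equal images have equal depth, and their parents have equal images too. By
  induction the parents coincide, and \<open>h\<close> is injective on siblings.\<close>

lemma inj_h: "inj_on h V"
proof -
  have "v = w" if "v \<in> V" "w \<in> V" "h v = h w" for v w
    using that
  proof (induction "d v" arbitrary: v w)
    case 0
    then show ?case using R.depth_0_iff depth_h by metis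
  next
    case (Suc n)
    then have d: "d v = Suc n" "d w = Suc n" using depth_h by metis+
    then have ne: "v \<noteq> c" "w \<noteq> c" using R.depth_root by auto
    have "h (f v) = h (f w)" using h_nonroot(3) Suc.prems ne by metis
    moreover have "n = d (f v)" using R.depth_parent[OF Suc.prems(1) ne(1)] d by simp
    ultimately have "f v = f w"
      using Suc.hyps(1)[of "f v" "f w"] R.parent_in Suc.prems ne by simp
    then have "v \<in> R.K (f v)" "w \<in> R.K (f v)" using Suc.prems ne by (auto simp: R.K_iff)
    then show ?case
      using bij_K[OF R.parent_in[OF Suc.prems(1) ne(1)]] Suc.prems(3)
      by (auto simp: bij_betw_def dest: inj_onD)
  qed
  then show ?thesis by (auto intro: inj_onI)
qed

lemma image_h: "h ` V = V'"
proof (intro equalityI subsetI)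
  fix v' assume "v' \<in> V'"
  then show "v' \<in> h ` V"
  proof (induction "d' v'" arbitrary: v')
    case 0
    then show ?case using R'.depth_0_iff h_root R.root_in by auto
  next
    case (Suc n)
    then have v': "v' \<noteq> c'" using R'.depth_root by auto
    obtain x where x: "x \<in> V" "h x = f' v'"
      using Suc.hyps(1)[of "f' v'"] Suc.hyps(2) R'.depth_parent[OF Suc.prems v'] R'.parent_in[OF Suc.prems v']
      by auto
    have "v' \<in> R'.K (h x)" using x Suc.prems v' by (simp add: R'.K_iff)
    then have "v' \<in> h ` R.K x" using bij_K[OF x(1)] by (auto simp: bij_betw_def)
    then show ?case by (auto simp: R.K_iff)
  qed
qed (use h_in in auto)

lemma tree_graph_image:
  "R'.G = \<lparr>pverts = h ` pverts R.G, parcs = map_prod h h ` parcs R.G\<rparr>"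
proof -
  have V': "V' - {c'} = h ` (V - {c})"
    using inj_on_image_set_diff[OF inj_h, of V "{c}"] image_h h_root R.root_in by auto
  have "(\<lambda>v. (v, f' v)) ` (V' - {c'}) = (\<lambda>v. (h v, h (f v))) ` (V - {c})"
    "(\<lambda>v. (f' v, v)) ` (V' - {c'}) = (\<lambda>v. (h (f v), h v)) ` (V - {c})"
    unfolding V' image_image using h_nonroot(3) by (auto intro!: image_cong)
  then show ?thesis
    by (simp add: tree_graph_def image_h image_Un image_image)
qed

lemma nested_code_eq: "nested_code V' c' f' = nested_code V c f"
proof -
  have K': "mset_set (R'.K (h x)) = image_mset h (mset_set (R.K x))" if "x \<in> V" for x
    using bij_K[OF that] by (simp add: bij_betw_def image_mset_mset_set)
  have card: "card (R'.K (h x)) = card (R.K x)" if "x \<in> V" for x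
    using bij_betw_same_card[OF bij_K[OF that]] by simp
  have "{#card (R'.K x) + 1. x \<in># mset_set (R'.K (h r))#} = {#card (R.K x) + 1. x \<in># mset_set (R.K r)#}"
    if "r \<in> V" for r
    using card by (auto simp: K'[OF that] multiset.map_comp R.K_iff intro!: image_mset_cong)
  moreover have "mset_set (R'.K c') = image_mset h (mset_set (R.K c))"
    using K'[OF R.root_in] h_root by simp
  ultimately show ?thesis
    unfolding nested_code_def
    by (auto simp: multiset.map_comp R.K_iff intro!: image_mset_cong)
qed

lemma branch_of_h: "v \<in> V \<Longrightarrow> v \<noteq> c \<Longrightarrow> R'.branch_of (h v) = h (R.branch_of v)"
proof (induction "d v" arbitrary: v)
  case (Suc n)
  show ?case
  proof (cases "f v = c")
    case True
    then have "v \<in> R.K c" "h v \<in> R'.K c'"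
      using Suc.prems h_nonroot[OF Suc.prems] h_root by (auto simp: R.K_iff R'.K_iff)
    then show ?thesis using R.branch_of_kid R'.branch_of_kid by simp
  next
    case False
    have fv: "f v \<in> V" "n = d (f v)"
      using R.parent_in[OF Suc.prems] R.depth_parent[OF Suc.prems] Suc.hyps(2) by auto
    have "R'.branch_of (h (f v)) = R'.branch_of (h v)"
      using R'.branch_of_parent[of "h v"] h_nonroot[OF Suc.prems] h_nonroot(2)[OF fv(1) False] by simp
    then show ?thesis using Suc.hyps(1)[OF fv(2,1) False] R.branch_of_parent[OF Suc.prems False] by simp
  qed
qed (use R.depth_0_iff in auto)

lemma diam6_tree_image:
  assumes "diam6_tree V c f d u w"
  shows "diam6_tree V' c' f' d' (h u) (h w)"
proof -
  interpret diam6_tree V c f d u w by (rule assms)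
  have "u \<noteq> c" "w \<noteq> c" using far R.depth_root by auto
  then have "R.branch_of u \<in> V" "R.branch_of w \<in> V" using R.branch_of_in_kids far by (auto simp: R.K_iff)
  then have "R'.branch_of (h u) \<noteq> R'.branch_of (h w)"
    using branch_of_h far \<open>u \<noteq> c\<close> \<open>w \<noteq> c\<close> inj_h by (simp add: inj_on_eq_iff)
  moreover have "d' v' \<le> 3" if "v' \<in> V'" for v'
    using that depth_h depth_le by (auto simp flip: image_h)
  ultimately show ?thesis
    using far depth_h h_in by unfold_locales auto
qed

end

text \<open>Renaming vertices injectively carries the rooting along. This serves both for isomorphic
  copies and for moving a model to another vertex type.\<close>

lemma rooted_tree_transport:
  assumes "rooted_tree V c f d" "inj_on h V"
  shows "rooted_trees_local_bij V c f d (h ` V) (h c)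
    (\<lambda>x. h (f (inv_into V h x))) (\<lambda>x. d (inv_into V h x)) h"
proof -
  interpret rooted_tree V c f d by (rule assms)
  let ?f = "\<lambda>x. h (f (inv_into V h x))"
  interpret R': rooted_tree "h ` V" "h c" ?f "\<lambda>x. d (inv_into V h x)"
  proof
    show "?f v \<in> h ` V" if "v \<in> h ` V" "v \<noteq> h c" for v
    proof -
      from that obtain x where "x \<in> V" "v = h x" "x \<noteq> c" by auto
      then show ?thesis using assms(2) parent_in[of x] by simp
    qed
    show "d (inv_into V h v) = Suc (d (inv_into V h (?f v)))" if "v \<in> h ` V" "v \<noteq> h c" for v
    proof -
      from that obtain x where "x \<in> V" "v = h x" "x \<noteq> c" by auto
      then show ?thesis using assms(2) parent_in[of x] depth_parent[of x] by simp
    qed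
  qed (use assms(2) finite_V root_in depth_root in auto)
  have "bij_betw h (K x) (kids (h ` V) (h c) ?f (h x))" if "x \<in> V" for x
  proof -
    have "kids (h ` V) (h c) ?f (h x) = h ` K x"
      using assms(2) that root_in parent_in by (auto simp: kids_def inj_on_eq_iff)
    then show ?thesis
      using inj_on_subset[OF assms(2), of "K x"] by (auto simp: bij_betw_def kids_def)
  qed
  then show ?thesis
    by (intro rooted_trees_local_bij.intro rooted_trees_local_bij_axioms.intro)
      (auto simp: local_bij_def intro: R'.rooted_tree_axioms rooted_tree_axioms)
qed

text \<open>Equal multisets of values allow the elements to be paired off one at a time: each
  \<open>a\<close> finds a partner \<open>y\<close> of the same value, and removing both preserves
  the equality.\<close>

lemma image_mset_eq_imp_bij:
  assumes "finite A" "finite B" "image_mset g (mset_set A) = image_mset g' (mset_set B)"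
  shows "\<exists>h. bij_betw h A B \<and> (\<forall>a\<in>A. g' (h a) = g a)"
  using assms
proof (induction A arbitrary: B rule: finite_induct)
  case empty
  then have "B = {}" by (simp add: mset_set_empty_iff)
  then show ?case by (auto simp: bij_betw_def)
next
  case (insert a A)
  then have "g a \<in># image_mset g' (mset_set B)" by (metis finite.insertI finite_set_mset_mset_set image_eqI insertI1 set_image_mset)
  then obtain y where y: "y \<in> B" "g' y = g a" using insert.prems by auto
  then have "mset_set B = add_mset y (mset_set (B - {y}))"
    using insert.prems by (metis mset_set.remove)
  then have "image_mset g (mset_set A) = image_mset g' (mset_set (B - {y}))"
    using insert y by simp
  then obtain h where h: "bij_betw h A (B - {y})" "\<forall>a\<in>A. g' (h a) = g a"
    using insert.IH[of "B - {y}"] insert.prems by auto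
  have "bij_betw (h(a := y)) (insert a A) (insert y (B - {y}))"
    using h(1) insert.hyps by (subst bij_betw_def) (auto simp: bij_betw_def inj_on_def)
  then have "bij_betw (h(a := y)) (insert a A) B" using y(1) by (simp add: insert_absorb)
  then show ?case
    using h y insert.hyps by (intro exI[of _ "h(a := y)"]) (auto simp del: fun_upd_apply, auto)
qed

text \<open>Equal codes are matched level by level: branches with equal partitions, then the parts, then leaves.\<close>

lemma nested_code_eq_imp_local_bij:
  assumes "diam6_tree V c f d u w" "diam6_tree V' c' f' d' u' w'"
    and eq: "nested_code V c f = nested_code V' c' f'"
  obtains h where "rooted_trees_local_bij V c f d V' c' f' d' h"
proof -
  interpret R: diam6_tree V c f d u w by (rule assms)
  interpret R': diam6_tree V' c' f' d' u' w' by (rule assms)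
  define P where "P r = {#card (R.K x) + 1. x \<in># mset_set (R.K r)#}" for r
  define P' where "P' r = {#card (R'.K x) + 1. x \<in># mset_set (R'.K r)#}" for r
  have "image_mset P (mset_set (R.K c)) = image_mset P' (mset_set (R'.K c'))"
    using eq unfolding nested_code_def P_def[abs_def] P'_def[abs_def] .
  then obtain h1 where h1: "bij_betw h1 (R.K c) (R'.K c')" "\<And>r. r \<in> R.K c \<Longrightarrow> P' (h1 r) = P r"
    using image_mset_eq_imp_bij[OF R.finite_K R'.finite_K] by metis
  have "\<exists>g. bij_betw g (R.K r) (R'.K (h1 r)) \<and> (\<forall>x\<in>R.K r. card (R'.K (g x)) + 1 = card (R.K x) + 1)"
    if "r \<in> R.K c" for r
    using h1(2)[OF that] by (intro image_mset_eq_imp_bij) (simp_all add: P_def P'_def)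
  then obtain h2 where h2: "\<And>r. r \<in> R.K c \<Longrightarrow> bij_betw (h2 r) (R.K r) (R'.K (h1 r))"
    "\<And>r x. r \<in> R.K c \<Longrightarrow> x \<in> R.K r \<Longrightarrow> card (R'.K (h2 r x)) = card (R.K x)"
    by (metis add_right_cancel)
  \<comment> \<open>Leaves carry no further data, so equal cardinalities suffice at this
    level.\<close>
  have "\<exists>g. bij_betw g (R.K x) (R'.K (h2 r x))" if "r \<in> R.K c" "x \<in> R.K r" for r x
    using h2(2)[OF that] by (intro finite_same_card_bij) auto
  then obtain h3 where h3: "\<And>r x. r \<in> R.K c \<Longrightarrow> x \<in> R.K r \<Longrightarrow> bij_betw (h3 r x) (R.K x) (R'.K (h2 r x))"
    by metis
  \<comment> \<open>The matchings of branches, of their children and of leaves are glued according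
    to the number of parent steps to \<open>c\<close>. The tests are ordered so that the junk value
    \<open>f c\<close> is never consulted.\<close>
  define h where "h v = (if v = c then c' else if f v = c then h1 v
     else if f (f v) = c then h2 (f v) v else h3 (f (f v)) (f v) v)" for v
  have hr: "h r = h1 r" if "r \<in> R.K c" for r using that by (simp add: h_def R.K_iff)
  have hx: "h x = h2 r x" if "r \<in> R.K c" "x \<in> R.K r" for r x
    using that by (simp add: h_def R.K_iff)
  have hy: "h y = h3 r x y" if "r \<in> R.K c" "x \<in> R.K r" "y \<in> R.K x" for r x y
    using that by (simp add: h_def R.K_iff)
  have "bij_betw h (R.K v) (R'.K (h v))" if "v \<in> V" for v
  proof -
    have parent: "v = c \<or> v \<in> R.K (f v)" using that by (auto simp: R.K_iff)
    show ?thesis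
    proof (cases "v = c \<or> f v = c \<or> f (f v) = c")
      case True
      have fv: "v = c \<or> f v \<in> V" using R.parent_in[OF that] by blast
      from True consider "v = c" | "v \<in> R.K c" | r where "r \<in> R.K c" "v \<in> R.K r"
        using parent fv by (metis R.K_iff)
      then show ?thesis
      proof cases
        case 1
        have "bij_betw h (R.K c) (R'.K c') \<longleftrightarrow> bij_betw h1 (R.K c) (R'.K c')"
          by (rule bij_betw_cong) (rule hr)
        then show ?thesis using h1(1) 1 by (simp add: h_def)
      next
        case 2
        have "bij_betw h (R.K v) (R'.K (h1 v)) \<longleftrightarrow> bij_betw (h2 v) (R.K v) (R'.K (h1 v))"
          by (rule bij_betw_cong) (rule hx[OF 2])
        then show ?thesis using h2(1)[OF 2] hr[OF 2] by simp
      next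
        case 3
        have "bij_betw h (R.K v) (R'.K (h2 r v)) \<longleftrightarrow> bij_betw (h3 r v) (R.K v) (R'.K (h2 r v))"
          by (rule bij_betw_cong) (rule hy[OF 3])
        then show ?thesis using h3[OF 3] hx[OF 3] by simp
      qed
    next
      case False
      \<comment> \<open>The remaining \<open>v\<close> has parent \<open>x\<close> and grandparent
        \<open>r\<close> and lies at depth three, as does its image. Both are childless, so the
        required bijection is empty.\<close>
      define x r where "x = f v" and "r = f x"
      have x: "v \<in> R.K x" "x \<in> V" "x \<noteq> c" using False parent R.parent_in[OF that] by (auto simp: x_def)
      then have r: "x \<in> R.K r" "r \<in> V" "r \<noteq> c" using False R.parent_in[of x] by (auto simp: x_def r_def R.K_iff)
      have "d v = Suc (Suc (d r))" using R.depth_K[OF x(1)] R.depth_K[OF r(1)] by simp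
      moreover have "d r = Suc (d (f r))" using R.depth_parent r by simp
      ultimately have "d v = 3" "d (f r) = 0" using R.depth_le[OF that] by auto
      then have rc: "r \<in> R.K c" using R.depth_0_iff[OF R.parent_in[OF r(2,3)]] r by (simp add: R.K_iff)
      have "R.K v = {}"
        using R.depth_K[of _ v] R.depth_le \<open>d v = 3\<close> by (fastforce simp: R.K_iff)
      have "h1 r \<in> R'.K c'" using h1(1) rc by (auto simp: bij_betw_def)
      moreover have "h2 r x \<in> R'.K (h1 r)" using h2(1)[OF rc] r by (auto simp: bij_betw_def)
      moreover have "h v \<in> R'.K (h2 r x)" using h3[OF rc r(1)] hy[OF rc r(1) x(1)] x by (auto simp: bij_betw_def)
      ultimately have "d' (h v) = 3" using R'.depth_K R'.depth_root by fastforce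
      then have "R'.K (h v) = {}"
        using R'.depth_K[of _ "h v"] R'.depth_le by (fastforce simp: R'.K_iff)
      then show ?thesis using \<open>R.K v = {}\<close> by (simp add: bij_betw_def)
    qed
  qed
  then have "local_bij h V c f V' c' f'" by (simp add: local_bij_def h_def)
  then show ?thesis
    using that R.rooted_tree_axioms R'.rooted_tree_axioms
    by (auto intro: rooted_trees_local_bij.intro rooted_trees_local_bij_axioms.intro)
qed

text \<open>An isomorphism in the library also maps arcs and supplies new end maps. Since the target
  is a pair digraph, those are \<open>fst\<close> and \<open>snd\<close>, so the vertex map
  determines the arc map.\<close>

lemma digraph_iso_with_proj_iff:
  assumes "wf_digraph (with_proj T)"
  shows "digraph_iso (with_proj T) (with_proj T') \<longleftrightarrow>
    (\<exists>h. inj_on h (pverts T) \<and> T' = \<lparr>pverts = h ` pverts T, parcs = map_prod h h ` parcs T\<rparr>)"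
proof
  assume "digraph_iso (with_proj T) (with_proj T')"
  then obtain i where i: "pre_digraph.digraph_isomorphism (with_proj T) i"
    "with_proj T' = app_iso i (with_proj T)" by (auto simp: digraph_iso_def)
  have T': "pverts T' = iso_verts i ` pverts T" "parcs T' = iso_arcs i ` parcs T"
    "iso_tail i = fst" "iso_head i = snd"
    using arg_cong[OF i(2), of verts] arg_cong[OF i(2), of arcs]
      arg_cong[OF i(2), of tail] arg_cong[OF i(2), of head] by simp_all
  have "iso_arcs i e = map_prod (iso_verts i) (iso_verts i) e" if "e \<in> parcs T" for e
    using i(1) that T' by (auto simp: pre_digraph.digraph_isomorphism_def map_prod_def prod_eq_iff split: prod.split)
  then have "parcs T' = map_prod (iso_verts i) (iso_verts i) ` parcs T"
    unfolding T' by (rule image_cong[OF refl])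
  then show "\<exists>h. inj_on h (pverts T) \<and> T' = \<lparr>pverts = h ` pverts T, parcs = map_prod h h ` parcs T\<rparr>"
    using i(1) T' by (intro exI[of _ "iso_verts i"]) (auto simp: pre_digraph.digraph_isomorphism_def)
next
  assume "\<exists>h. inj_on h (pverts T) \<and> T' = \<lparr>pverts = h ` pverts T, parcs = map_prod h h ` parcs T\<rparr>"
  then obtain h where h: "inj_on h (pverts T)"
    "T' = \<lparr>pverts = h ` pverts T, parcs = map_prod h h ` parcs T\<rparr>" by auto
  have "parcs T \<subseteq> pverts T \<times> pverts T"
    using assms by (auto simp: wf_digraph_def)
  then have "inj_on (map_prod h h) (parcs T)"
    using inj_on_subset[OF map_prod_inj_on[OF h(1) h(1)]] by simp
  then show "digraph_iso (with_proj T) (with_proj T')"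
    unfolding digraph_iso_def using h assms
    by (intro exI[of _ "\<lparr>iso_verts = h, iso_arcs = map_prod h h, iso_head = snd, iso_tail = fst\<rparr>"])
      (auto simp: pre_digraph.digraph_isomorphism_def app_iso_def with_proj_def)
qed

section \<open>Realizing every admissible code\<close>

lemma mset_as_image: "mset xs = image_mset ((!) xs) (mset_set {..<length xs})"
  by (metis atLeast_upt map_nth mset_map mset_upt atLeast0LessThan)

text \<open>Vertices are addresses with the innermost index first, so that \<open>tl\<close> is the
  parent and \<open>length\<close> the depth.\<close>

lemma admissible_code_realized_on_lists:
  assumes "M \<in> admissible_codes"
  obtains V :: "nat list set" and f d u w
  where "diam6_tree V [] f d u w" "nested_code V [] f = M"
proof -
  obtain L where L: "mset L = M" using ex_mset by blast
  define l where "l i = (SOME xs. mset xs = L ! i)" for i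
  have l: "mset (l i) = L ! i" for i
    unfolding l_def by (rule someI_ex) (rule ex_mset)
  define n where "n = length L"
  have pos: "0 < l i ! j" if "i < n" "j < length (l i)" for i j
  proof -
    have "L ! i \<in># M" using that L by (auto simp: n_def)
    moreover have "l i ! j \<in># L ! i" using that by (simp flip: l)
    ultimately show ?thesis using assms by (auto simp: admissible_codes_def integer_partition_def)
  qed
  \<comment> \<open>Index \<open>i\<close> names a branch, \<open>j\<close> a part of its partition
    and \<open>k\<close> one of the leaves below it. A part \<open>q\<close> gets
    \<open>q - 1\<close> leaves; positivity of parts makes the truncated subtraction
    reversible.\<close>
  define V where "V = {[]} \<union> (\<Union>i<n. {[i]} \<union>
    (\<Union>j<length (l i). {[j, i]} \<union> (\<Union>k<l i ! j - 1. {[k, j, i]})))"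
  have V_iff: "v \<in> V \<longleftrightarrow> v = [] \<or> (\<exists>i<n. v = [i]) \<or> (\<exists>i<n. \<exists>j<length (l i). v = [j, i])
    \<or> (\<exists>i<n. \<exists>j<length (l i). \<exists>k<l i ! j - 1. v = [k, j, i])" for v
    unfolding V_def by blast
  interpret rooted_tree V "[]" tl length
  proof
    show "finite V" by (simp add: V_def)
  qed (auto simp: V_iff)
  have K0: "K [] = (\<lambda>i. [i]) ` {..<n}" by (auto simp: kids_def V_iff)
  have K1: "K [i] = (\<lambda>j. [j, i]) ` {..<length (l i)}" if "i < n" for i
    using that by (auto simp: kids_def V_iff)
  have K2: "K [j, i] = (\<lambda>k. [k, j, i]) ` {..<l i ! j - 1}" if "i < n" "j < length (l i)" for i j
    using that by (auto simp: kids_def V_iff)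
  have "card (K [j, i]) + 1 = l i ! j" if "i < n" "j < length (l i)" for i j
    using pos[OF that] by (simp add: K2[OF that] card_image inj_on_def)
  then have part: "{#card (K x) + 1. x \<in># mset_set (K [i])#} = L ! i" if "i < n" for i
    using that unfolding l[symmetric] mset_as_image[of "l i"]
    by (auto simp: K1 image_mset_mset_set[symmetric] inj_on_def multiset.map_comp intro!: image_mset_cong)
  have code: "nested_code V [] tl = M"
    unfolding nested_code_def L[symmetric] mset_as_image[of L]
    using part by (auto simp: K0 n_def image_mset_mset_set[symmetric] inj_on_def multiset.map_comp intro!: image_mset_cong)
  \<comment> \<open>Indices count members with multiplicity, so even two equal partitions give
    distinct indices and hence distinct branches. The first leaf \<open>[0, j, i]\<close> under a
    part of at least two then has depth three.\<close>
  have "2 \<le> size {#\<pi> \<in># M. \<exists>q \<in># \<pi>. 2 \<le> q#}"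
    using assms by (simp add: admissible_codes_def)
  also have "\<dots> = card {i \<in> {..<n}. \<exists>q \<in># L ! i. 2 \<le> q}"
    unfolding L[symmetric] mset_as_image[of L] by (simp add: filter_mset_image_mset filter_mset_mset_set n_def)
  finally have "\<not> card {i \<in> {..<n}. \<exists>q \<in># L ! i. 2 \<le> q} \<le> Suc 0" by simp
  then obtain i i' where i: "i < n" "i' < n" "i \<noteq> i'" "\<exists>q \<in># L ! i. 2 \<le> q" "\<exists>q \<in># L ! i'. 2 \<le> q"
    by (subst (asm) card_le_Suc0_iff_eq) auto
  have long: "\<exists>j. [0, j, i] \<in> V" if "i < n" "\<exists>q \<in># L ! i. 2 \<le> q" for i
  proof -
    from that(2) obtain j where "j < length (l i)" "2 \<le> l i ! j"
      by (auto simp: l[symmetric] in_set_conv_nth)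
    then show ?thesis using that(1) by (auto simp: V_iff intro!: exI[of _ j])
  qed
  obtain j j' where "[0, j, i] \<in> V" "[0, j', i'] \<in> V" using long i by blast
  then have "diam6_tree V [] tl length [0, j, i] [0, j', i']"
    using i(3) by unfold_locales (auto simp: V_iff branch_of_def)
  then show ?thesis using that code by blast
qed

text \<open>An infinite vertex type has room for every finite tree: addresses are coded as natural
  numbers, which inject into \<open>'a\<close>.\<close>

lemma admissible_code_realized:
  assumes "infinite (UNIV :: 'a set)" "M \<in> admissible_codes"
  obtains T :: "'a pair_pre_digraph" where "T \<in> diam6_trees" "diam6_code T = M"
proof -
  obtain V :: "nat list set" and f d u w
    where V: "diam6_tree V [] f d u w" and code: "nested_code V [] f = M"
    using admissible_code_realized_on_lists[OF assms(2)] by blast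
  obtain e :: "nat \<Rightarrow> 'a" where "inj e"
    using assms(1) infinite_countable_subset by blast
  define h where "h = e \<circ> (to_nat :: nat list \<Rightarrow> nat)"
  have inj: "inj_on h V"
    using \<open>inj e\<close> unfolding h_def by (meson inj_compose inj_on_subset inj_to_nat subset_UNIV)
  interpret rooted_trees_local_bij V "[]" f d "h ` V" "h []"
    "\<lambda>x. h (f (inv_into V h x))" "\<lambda>x. d (inv_into V h x)" h
    by (rule rooted_tree_transport[OF diam6_tree.axioms(1)[OF V] inj])
  show ?thesis
    using that[of R'.G] diam6_tree.G_in_diam6_trees[OF diam6_tree_image[OF V]]
      diam6_tree.diam6_code_G[OF diam6_tree_image[OF V]] nested_code_eq code by simp
qed

section \<open>Isomorphism classes and the bijection\<close>

lemma wf_diam6: "T \<in> diam6_trees \<Longrightarrow> wf_digraph (with_proj T)"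
  by (simp add: diam6_trees_def undirected_tree_def graph_def digraph_def fin_digraph_def)

lemma diam6_code_eq_iff_iso:
  assumes "T \<in> diam6_trees" "T' \<in> diam6_trees"
  shows "diam6_code T = diam6_code T' \<longleftrightarrow> digraph_iso (with_proj T) (with_proj T')"
proof
  obtain c f d u w where R: "diam6_tree (pverts T) c f d u w" and T: "T = tree_graph (pverts T) c f"
    using diam6_trees_rooted[OF assms(1)] by blast
  interpret R: diam6_tree "pverts T" c f d u w by (rule R)
  have code: "diam6_code T = nested_code (pverts T) c f" using R.diam6_code_G T by simp
  {
    assume eq: "diam6_code T = diam6_code T'"
    obtain c' f' d' u' w' where R': "diam6_tree (pverts T') c' f' d' u' w'"
      and T': "T' = tree_graph (pverts T') c' f'"
      using diam6_trees_rooted[OF assms(2)] by blast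
    have "diam6_code T' = nested_code (pverts T') c' f'"
      using diam6_tree.diam6_code_G[OF R'] T' by simp
    with eq code have "nested_code (pverts T) c f = nested_code (pverts T') c' f'" by simp
    then obtain h where "rooted_trees_local_bij (pverts T) c f d (pverts T') c' f' d' h"
      using nested_code_eq_imp_local_bij[OF R R'] by blast
    then interpret rooted_trees_local_bij "pverts T" c f d "pverts T'" c' f' d' h .
    show "digraph_iso (with_proj T) (with_proj T')"
      using digraph_iso_with_proj_iff[OF wf_diam6[OF assms(1)]] inj_h tree_graph_image T T' by metis
  }
  assume "digraph_iso (with_proj T) (with_proj T')"
  then obtain h where h: "inj_on h (pverts T)"
    "T' = \<lparr>pverts = h ` pverts T, parcs = map_prod h h ` parcs T\<rparr>"
    using digraph_iso_with_proj_iff[OF wf_diam6[OF assms(1)]] by blast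
  \<comment> \<open>The transported rooting of \<open>T'\<close> again satisfies
    \<open>diam6_tree\<close>, so \<open>h c\<close> is the centre of \<open>T'\<close> and its code
    can be computed there.\<close>
  interpret rooted_trees_local_bij "pverts T" c f d "h ` pverts T" "h c"
    "\<lambda>x. h (f (inv_into (pverts T) h x))" "\<lambda>x. d (inv_into (pverts T) h x)" h
    by (rule rooted_tree_transport[OF diam6_tree.axioms(1)[OF R] h(1)])
  have "T' = R'.G" using tree_graph_image T h(2) by simp
  then show "diam6_code T = diam6_code T'"
    using diam6_tree.diam6_code_G[OF diam6_tree_image[OF R]] nested_code_eq code by simp
qed

text \<open>Isomorphism is thus the kernel of the code on these trees, from which the equivalence
  properties and well-definedness on classes follow.\<close>

lemma diam6_iso_iff_code:
  "(T, T') \<in> diam6_iso \<longleftrightarrow> T \<in> diam6_trees \<and> T' \<in> diam6_trees \<and> diam6_code T = diam6_code T'"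
  using diam6_code_eq_iff_iso by (auto simp: diam6_iso_def)

lemma equiv_diam6_iso: "equiv diam6_trees diam6_iso"
  by (rule equivI) (auto simp: refl_on_def sym_def trans_def diam6_iso_iff_code)

lemma diam6_code_admissible: "T \<in> diam6_trees \<Longrightarrow> diam6_code T \<in> admissible_codes"
  by (metis diam6_trees_rooted diam6_tree.code_admissible)

lemma bij_betw_quotient_code:
  assumes "infinite (UNIV :: 'a set)"
  shows "bij_betw (\<lambda>C. the_elem (diam6_code ` C))
    ((diam6_trees :: 'a pair_pre_digraph set) // diam6_iso) admissible_codes"
proof -
  \<comment> \<open>The code is constant on a class, so the image of the class is a singleton and
    \<open>the_elem\<close> returns that value.\<close>
  have elem: "the_elem (diam6_code ` (diam6_iso `` {T})) = diam6_code T" if "T \<in> diam6_trees" for T :: "'a pair_pre_digraph"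
  proof -
    have "diam6_code ` (diam6_iso `` {T}) = {diam6_code T}"
      using that by (auto simp: diam6_iso_iff_code)
    then show ?thesis by simp
  qed
  have "inj_on (\<lambda>C. the_elem (diam6_code ` C)) ((diam6_trees :: 'a pair_pre_digraph set) // diam6_iso)"
  proof (rule inj_onI)
    fix C C' assume "C \<in> (diam6_trees :: 'a pair_pre_digraph set) // diam6_iso"
      "C' \<in> (diam6_trees :: 'a pair_pre_digraph set) // diam6_iso"
      "the_elem (diam6_code ` C) = the_elem (diam6_code ` C')"
    then obtain T T' :: "'a pair_pre_digraph" where "T \<in> diam6_trees" "C = diam6_iso `` {T}"
      "T' \<in> diam6_trees" "C' = diam6_iso `` {T'}" "diam6_code T = diam6_code T'"
      by (auto simp: elem elim!: quotientE)
    then show "C = C'" by (auto simp: diam6_iso_iff_code)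
  qed
  moreover have "(\<lambda>C. the_elem (diam6_code ` C)) ` ((diam6_trees :: 'a pair_pre_digraph set) // diam6_iso)
    = admissible_codes"
  proof (intro equalityI subsetI)
    fix M assume "M \<in> (\<lambda>C. the_elem (diam6_code ` C)) ` ((diam6_trees :: 'a pair_pre_digraph set) // diam6_iso)"
    then show "M \<in> admissible_codes"
      by (auto simp: elem diam6_code_admissible elim!: quotientE)
  next
    fix M :: "nat multiset multiset" assume "M \<in> admissible_codes"
    then obtain T :: "'a pair_pre_digraph" where "T \<in> diam6_trees" "diam6_code T = M"
      using admissible_code_realized[OF assms] by blast
    then show "M \<in> (\<lambda>C. the_elem (diam6_code ` C)) ` ((diam6_trees :: 'a pair_pre_digraph set) // diam6_iso)"
      by (intro image_eqI[of _ _ "diam6_iso `` {T}"]) (auto simp: elem quotientI)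
  qed
  ultimately show ?thesis by (simp add: bij_betw_def)
qed

lemma diam6_branch_structure:
  assumes "T \<in> diam6_trees"
  shows "(\<exists>!c. central_vertex (with_proj T) c) \<and>
      (\<forall>c B. central_vertex (with_proj T) c \<and> B \<in> branches (with_proj T) c \<longrightarrow>
         (\<exists>!r. r \<in> verts B \<and> (c, r) \<in> arcs_ends (with_proj T)) \<and>
         (\<forall>r. r \<in> verts B \<and> (c, r) \<in> arcs_ends (with_proj T) \<longrightarrow>
            height B r \<le> 2 \<and>
            (\<forall>x \<in> children B r r. \<forall>y \<in> children B r x. children B r y = {})))"
proof -
  obtain c f d u w where R: "diam6_tree (pverts T) c f d u w" and T: "T = tree_graph (pverts T) c f"
    using diam6_trees_rooted[OF assms] by blast
  have central: "central_vertex (with_proj T) x \<longleftrightarrow> x = c" for x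
    using diam6_tree.central_iff[OF R] T by metis
  have branch: "(\<exists>!r. r \<in> verts B \<and> (c, r) \<in> arcs_ends (with_proj T)) \<and>
         (\<forall>r. r \<in> verts B \<and> (c, r) \<in> arcs_ends (with_proj T) \<longrightarrow>
            height B r \<le> 2 \<and>
            (\<forall>x \<in> children B r r. \<forall>y \<in> children B r x. children B r y = {}))"
    if "B \<in> branches (with_proj T) c" for B
    using diam6_tree.branch_structure[OF R, of B, folded T, OF that] by blast
  show ?thesis
  proof (rule conjI)
    show "\<exists>!c. central_vertex (with_proj T) c" by (simp add: central)
  qed (intro allI impI, elim conjE, simp only: central, rule branch)
qed

lemma diam6_card:
  assumes "T \<in> diam6_trees"
  shows "card (pverts T) = 1 + (\<Sum>\<pi> \<in># diam6_code T. 1 + sum_mset \<pi>)"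
  by (metis assms diam6_trees_rooted diam6_tree.card_V)

theorem mainTheorem3:
  "(\<forall>T :: 'a pair_pre_digraph. T \<in> diam6_trees \<longrightarrow>
      (\<exists>!c. central_vertex (with_proj T) c) \<and>
      (\<forall>c B. central_vertex (with_proj T) c \<and> B \<in> branches (with_proj T) c \<longrightarrow>
         (\<exists>!r. r \<in> verts B \<and> (c, r) \<in> arcs_ends (with_proj T)) \<and>
         (\<forall>r. r \<in> verts B \<and> (c, r) \<in> arcs_ends (with_proj T) \<longrightarrow>
            height B r \<le> 2 \<and>
            (\<forall>x \<in> children B r r. \<forall>y \<in> children B r x. children B r y = {})))) \<and>
   equiv (diam6_trees :: 'a pair_pre_digraph set) diam6_iso \<and>
   (diam6_code :: 'a pair_pre_digraph \<Rightarrow> nat multiset multiset) respects diam6_iso \<and>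
   (infinite (UNIV :: 'a set) \<longrightarrow>
      bij_betw (\<lambda>C. the_elem (diam6_code ` C))
        ((diam6_trees :: 'a pair_pre_digraph set) // diam6_iso) admissible_codes) \<and>
   (\<forall>T :: 'a pair_pre_digraph. T \<in> diam6_trees \<longrightarrow>
      card (pverts T) = 1 + (\<Sum>\<pi> \<in># diam6_code T. 1 + sum_mset \<pi>))"
proof (intro conjI)
  show "(diam6_code :: 'a pair_pre_digraph \<Rightarrow> nat multiset multiset) respects diam6_iso"
    by (auto simp: congruent_def diam6_iso_iff_code)
qed (use diam6_branch_structure equiv_diam6_iso bij_betw_quotient_code diam6_card in blast)+

end
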